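(* Let the layers of the Pearl Causal Hierarchy be indexed by $\{1,2,2.25,2.5,3\}$, as defined in the context. (a) Let $i\in\{2,2.25,2.5\}$ and let $Q=P(\mathbf Y_\star)$ be a query that (relative to some causal diagram) belongs to $\mathcal L_i$ and to no lower layer. Then for every layer index $j<i$ there exists a causal diagram $\mathcal G$, relative to which $Q$ belongs to $\mathcal L_i$ and no lower layer, such that $Q$ is identifiable from $\mathcal G$ and input data from $\mathcal L_j$. (b) This fails for $i=3$: if $Q=P(\mathbf Y_\star)$ belongs to $\mathcal L_3\setminus\mathcal L_{2.5}$ relative to a causal diagram $\mathcal G$, then $Q$ is not identifiable from $\mathcal G$ and input data from $\mathcal L_{2.5}$ (hence not from $\mathcal L_j$ for any $j<3$).
   Context: **SCMs and diagrams.** A (recursive) SCM $\mathcal M=\langle\mathbf V,\mathbf U,\mathcal F,P(\mathbf u)\rangle$ has finitely many observable finite-domain variables $\mathbf V$, exogenous $\mathbf U\sim P(\mathbf u)$, and functions $V_i\leftarrow f_i(\mathbf{Pa}_i,\mathbf U_i)$, acyclic. A causal diagram $\mathcal G$ has vertices $\mathbf V$, directed and bidirected edges; $\mathcal M$ is compatible with $\mathcal G$ if $\mathbf{Pa}_i$ are the parents of $V_i$ in $\mathcal G$ and $\mathbf U_i,\mathbf U_j$ may be dependent only if $V_i\leftrightarrow V_j$ is in $\mathcal G$ (functions may ignore arguments). $\mathcal G_{\overline{\mathbf X}}$ (resp. $\mathcal G_{\underline{\mathbf X}}$) removes edges into (resp. out of) $\mathbf X$; $An(\cdot)$ denotes ancestors,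 including the vertex itself. $Y_{\mathbf x}(\mathbf u)$, $Y\notin\mathbf X$, is the value of $Y$ when the functions of $\mathbf X$ are replaced by constants $\mathbf x$. For a set $\mathbf Y_\star$ of potential responses with constant subscripts, $P(\mathbf Y_\star=\mathbf y)=\sum_{\mathbf u}\prod_{Y_{\mathbf x}\in\mathbf Y_\star}\mathbb 1[Y_{\mathbf x}(\mathbf u)=y]P(\mathbf u)$. All distributions used as data are assumed positive. A query $Q$ is a distribution $P(\mathbf Y_\star)$ (values $\mathbf y$ are free indices). **Layers**, relative to $\mathcal G$ (each contained in the next): - $\mathcal L_1$: all subscripts in $\mathbf Y_\star$ are empty. $\mathcal L_2$: all subscripts are the same $\mathbf x$. $\mathcal L_3$: all $P(\mathbf Y_\star)$. - $\mathcal L_{2.25}$: there are $\mathbf X\subseteq\mathbf V$ and a single value vector $\mathbf x$ such that $\mathbf Y_\star$ contains at most one potential response $V_{j[\mathbf x_j]}$ of each variable, each $\mathbf x_j$ is a sub-vector of $\mathbf x$ not involving $V_j$, and whenever $X\in\mathbf X\setminus\{V_j\}$ is an ancestor of $V_j$ in $\mathcal G_{\overline{\mathbf X\setminus\{V_j\}}}$, the value of $X$ in $\mathbf x$ is included in $\mathbf x_j$. (These are the distributions obtainable with at most one counterfactual randomization per variable, affecting all its children.) - $\mathcal L_{2.5}$: the distributions physically realizable, in principle, if counterfactual randomization were available for every edge of $\mathcal G$. Equivalently: the set of counterfactual ancestors $An(\mathbf Y_\star)=\bigcup_{Y_{\mathbf x}\in\mathbf Y_\star}\{W_{\mathbf z}:W\in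 An(Y)_{\mathcal G_{\underline{\mathbf X}}},\ \mathbf z=\mathbf x\cap An(W)_{\mathcal G_{\overline{\mathbf X}}}\}$ contains no pair $W_{\mathbf t},W_{\mathbf s}$ of the same variable with $\mathbf t\ne\mathbf s$. **Identifiability.** $Q=P(\mathbf Y_\star)$ is identifiable from $\mathcal G$ and input data from $\mathcal L_j$ if any two SCMs compatible with $\mathcal G$ (with the same finite domains) that agree on all distributions in $\mathcal L_j$ (relative to $\mathcal G$) agree on $P(\mathbf Y_\star=\mathbf y)$ for every $\mathbf y$. *)

theory Defs
  imports "HOL-Probability.Probability"
begin

record 'v diagram =
  verts :: "'v set"
  dedges :: "('v \<times> 'v) set"
  bedges :: "('v \<times> 'v) set"

text \<open>A pair \<open>(a, b)\<close> in \<^const>\<open>dedges\<close> is the edge from \<open>a\<close> to \<open>b\<close>;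
  a bidirected edge is stored in both orientations.\<close>

definition causal_diagram :: "'v diagram \<Rightarrow> bool" where
  "causal_diagram G \<longleftrightarrow>
     finite (verts G) \<and>
     dedges G \<subseteq> verts G \<times> verts G \<and> acyclic (dedges G) \<and>
     bedges G \<subseteq> verts G \<times> verts G \<and> sym (bedges G) \<and> irrefl (bedges G)"

definition parents :: "'v diagram \<Rightarrow> 'v \<Rightarrow> 'v set" where
  "parents G v = {w. (w, v) \<in> dedges G}"

definition ancestors :: "'v diagram \<Rightarrow> 'v \<Rightarrow> 'v set" where
  "ancestors G v = {w. (w, v) \<in> (dedges G)\<^sup>*}"

text \<open>\<open>cut_in G X\<close> is the diagram with \<open>X\<close> overlined (a bidirected edge points into both of its
  ends), \<open>cut_out G X\<close> the one with \<open>X\<close> underlined.\<close>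

definition cut_in :: "'v diagram \<Rightarrow> 'v set \<Rightarrow> 'v diagram" where
  "cut_in G X = G\<lparr>dedges := {(a, b) \<in> dedges G. b \<notin> X},
                  bedges := {(a, b) \<in> bedges G. a \<notin> X \<and> b \<notin> X}\<rparr>"

definition cut_out :: "'v diagram \<Rightarrow> 'v set \<Rightarrow> 'v diagram" where
  "cut_out G X = G\<lparr>dedges := {(a, b) \<in> dedges G. a \<notin> X}\<rparr>"

text \<open>Observable values are labelled by natural numbers.  As distributions over \<open>U\<close> are discrete,
  so are the values of the exogenous variables, which are themselves indexed by natural numbers.
  The function of \<open>v\<close> is handed only the values of \<open>pa M v\<close> and of the exogenous variables in
  \<open>exo M v\<close>; see \<open>mechanism\<close>.\<close>

record 'v scm =
  obs :: "'v set"
  vals :: "'v \<Rightarrow> nat set"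
  pa :: "'v \<Rightarrow> 'v set"
  exo :: "'v \<Rightarrow> nat set"
  fn :: "'v \<Rightarrow> ('v \<Rightarrow> nat) \<Rightarrow> (nat \<Rightarrow> nat) \<Rightarrow> nat"
  pu :: "(nat \<Rightarrow> nat) pmf"

definition mechanism :: "'v scm \<Rightarrow> (nat \<Rightarrow> nat) \<Rightarrow> 'v \<Rightarrow> ('v \<Rightarrow> nat) \<Rightarrow> nat" where
  "mechanism M u v s = fn M v (restrict s (pa M v)) (restrict u (exo M v))"

definition recursive_scm :: "'v scm \<Rightarrow> bool" where
  "recursive_scm M \<longleftrightarrow>
     finite (obs M) \<and>
     (\<forall>v\<in>obs M. finite (vals M v) \<and> pa M v \<subseteq> obs M) \<and>
     acyclic {(w, v). v \<in> obs M \<and> w \<in> pa M v} \<and>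
     (\<forall>v\<in>obs M. \<forall>u. \<forall>s. (\<forall>w\<in>pa M v. s w \<in> vals M w) \<longrightarrow> mechanism M u v s \<in> vals M v)"

definition exo_indep :: "'v scm \<Rightarrow> 'v set \<Rightarrow> 'v set \<Rightarrow> bool" where
  "exo_indep M A B \<longleftrightarrow>
     prob_space.indep_var (measure_pmf (pu M))
       (count_space UNIV) (\<lambda>u. restrict u (\<Union>a\<in>A. exo M a))
       (count_space UNIV) (\<lambda>u. restrict u (\<Union>b\<in>B. exo M b))"

text \<open>The absence of bidirected edges is read as independence of whole families: with no
  bidirected edge at all, the exogenous arguments of the variables are jointly, and not merely
  pairwise, independent.\<close>

definition compatible :: "'v scm \<Rightarrow> 'v diagram \<Rightarrow> bool" where
  "compatible M G \<longleftrightarrow>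
     obs M = verts G \<and>
     (\<forall>v\<in>verts G. pa M v = parents G v) \<and>
     (\<forall>A B. A \<subseteq> verts G \<and> B \<subseteq> verts G \<and> A \<inter> B = {} \<and> (\<forall>a\<in>A. \<forall>b\<in>B. (a, b) \<notin> bedges G)
        \<longrightarrow> exo_indep M A B)"

text \<open>A subscript is a partial assignment, and \<open>(Y, x)\<close> stands for the potential response
  \<open>Y\<^sub>x\<close>.  A query is given by its set of potential responses.\<close>

type_synonym 'v subscript = "'v \<Rightarrow> nat option"
type_synonym 'v response = "'v \<times> 'v subscript"
type_synonym 'v query = "'v response set"

definition solves :: "'v scm \<Rightarrow> 'v subscript \<Rightarrow> (nat \<Rightarrow> nat) \<Rightarrow> ('v \<Rightarrow> nat) \<Rightarrow> bool" where
  "solves M x u s \<longleftrightarrow>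
     s \<in> extensional (obs M) \<and>
     (\<forall>v\<in>obs M. s v = (case x v of Some c \<Rightarrow> c | None \<Rightarrow> mechanism M u v s))"

lemma solves_ex1:
  assumes "recursive_scm M"
  shows "\<exists>!s. solves M x u s"
proof -
  let ?r = "{(w, v). v \<in> obs M \<and> w \<in> pa M v}"
  have fin: "finite (obs M)" and sub: "\<And>v. v \<in> obs M \<Longrightarrow> pa M v \<subseteq> obs M"
    and acy: "acyclic ?r"
    using assms unfolding recursive_scm_def by blast+
  have "?r \<subseteq> obs M \<times> obs M"
    using sub by blast
  then have "finite ?r"
    using fin by (meson finite_SigmaI finite_subset)
  then have wf: "wf ?r"
    using acy by (rule finite_acyclic_wf)
  let ?F = "\<lambda>g v. case x v of Some c \<Rightarrow> c | None \<Rightarrow> mechanism M u v g"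
  let ?f = "wfrec ?r ?F"
  have f: "?f v = ?F ?f v" if "v \<in> obs M" for v
  proof -
    have "restrict (cut ?f ?r v) (pa M v) = restrict ?f (pa M v)"
      using that by (auto simp: restrict_def cut_def)
    then show ?thesis
      by (subst wfrec[OF wf]) (simp add: mechanism_def split: option.split)
  qed
  have local: "mechanism M u v s = mechanism M u v t"
    if "\<And>w. w \<in> pa M v \<Longrightarrow> s w = t w" for v s t
    using that unfolding mechanism_def by (metis restrict_ext)
  have "solves M x u (restrict ?f (obs M))"
    unfolding solves_def
  proof (intro conjI ballI)
    fix v assume v: "v \<in> obs M"
    then have "mechanism M u v ?f = mechanism M u v (restrict ?f (obs M))"
      using sub by (intro local) auto
    then show "restrict ?f (obs M) v =
        (case x v of Some c \<Rightarrow> c | None \<Rightarrow> mechanism M u v (restrict ?f (obs M)))"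
      using v f[OF v] by (simp split: option.split)
  qed simp
  moreover have "s = t" if "solves M x u s" "solves M x u t" for s t
  proof -
    have "v \<in> obs M \<longrightarrow> s v = t v" for v
    proof (induction v rule: wf_induct_rule[OF wf])
      case (1 v)
      show ?case
      proof
        assume v: "v \<in> obs M"
        then have "mechanism M u v s = mechanism M u v t"
          using 1 sub by (intro local) auto
        then show "s v = t v"
          using that v unfolding solves_def by (auto split: option.split)
      qed
    qed
    then show ?thesis
      using that unfolding solves_def by (metis extensionalityI)
  qed
  ultimately show ?thesis by blast
qed

definition response :: "'v scm \<Rightarrow> (nat \<Rightarrow> nat) \<Rightarrow> 'v response \<Rightarrow> nat" where
  "response M u r = (THE s. solves M (snd r) u s) (fst r)"

definition query_prob :: "'v scm \<Rightarrow> 'v query \<Rightarrow> ('v response \<Rightarrow> nat) \<Rightarrow> real" where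
  "query_prob M Q y = measure_pmf.prob (pu M) {u. \<forall>r\<in>Q. response M u r = y r}"

definition query_over :: "'v set \<Rightarrow> 'v query \<Rightarrow> bool" where
  "query_over V Q \<longleftrightarrow>
     finite Q \<and> (\<forall>(Y, x)\<in>Q. Y \<in> V \<and> dom x \<subseteq> V \<and> Y \<notin> dom x)"

definition subscripts_in :: "('v \<Rightarrow> nat set) \<Rightarrow> 'v query \<Rightarrow> bool" where
  "subscripts_in D Q \<longleftrightarrow> (\<forall>(Y, x)\<in>Q. \<forall>w\<in>dom x. the (x w) \<in> D w)"

definition ctf_ancestors :: "'v diagram \<Rightarrow> 'v query \<Rightarrow> 'v response set" where
  "ctf_ancestors G Q =
     (\<Union>(Y, x)\<in>Q. {(W, x |` ancestors (cut_in G (dom x)) W) | W.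
                      W \<in> ancestors (cut_out G (dom x)) Y})"

datatype layer = L1 | L2 | L2_25 | L2_5 | L3

primrec layer_index :: "layer \<Rightarrow> real" where
  "layer_index L1 = 1"
| "layer_index L2 = 2"
| "layer_index L2_25 = 2.25"
| "layer_index L2_5 = 2.5"
| "layer_index L3 = 3"

primrec layer_condition :: "'v diagram \<Rightarrow> layer \<Rightarrow> 'v query \<Rightarrow> bool" where
  "layer_condition G L1 Q \<longleftrightarrow> (\<forall>(Y, x)\<in>Q. x = Map.empty)"
| "layer_condition G L2 Q \<longleftrightarrow> (\<exists>z. \<forall>(Y, x)\<in>Q. x = z)"
| "layer_condition G L2_25 Q \<longleftrightarrow>
     (\<exists>X\<subseteq>verts G. \<exists>x. dom x = X \<and>
        (\<forall>(V, v)\<in>Q. \<forall>(W, w)\<in>Q. V = W \<longrightarrow> v = w) \<and>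
        (\<forall>(V, v)\<in>Q. v \<subseteq>\<^sub>m x \<and> V \<notin> dom v \<and>
           (\<forall>A\<in>X - {V}. A \<in> ancestors (cut_in G (X - {V})) V \<longrightarrow> A \<in> dom v)))"
| "layer_condition G L2_5 Q \<longleftrightarrow>
     (\<forall>(V, v)\<in>ctf_ancestors G Q. \<forall>(W, w)\<in>ctf_ancestors G Q. V = W \<longrightarrow> v = w)"
| "layer_condition G L3 Q \<longleftrightarrow> True"

definition in_layer :: "'v diagram \<Rightarrow> layer \<Rightarrow> 'v query \<Rightarrow> bool" where
  "in_layer G i Q \<longleftrightarrow> query_over (verts G) Q \<and> layer_condition G i Q"

definition exactly_in_layer :: "'v diagram \<Rightarrow> layer \<Rightarrow> 'v query \<Rightarrow> bool" where
  "exactly_in_layer G i Q \<longleftrightarrow>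
     in_layer G i Q \<and> (\<forall>k. layer_index k < layer_index i \<longrightarrow> \<not> in_layer G k Q)"

text \<open>In every model compatible with \<open>G\<close>, \<open>Y\<^sub>x\<close> is the same variable as \<open>Y\<^sub>z\<close>, where \<open>z\<close> is
  the part of \<open>x\<close> on ancestors of \<open>Y\<close> in the diagram with the subscripted variables overlined.
  Two elements of a query that reduce to the same \<open>Y\<^sub>z\<close> are therefore two names of one variable,
  and positivity of their joint distribution can only refer to value vectors that give them the
  same value.\<close>

definition reduced :: "'v diagram \<Rightarrow> 'v response \<Rightarrow> 'v response" where
  "reduced G r = (fst r, snd r |` ancestors (cut_in G (dom (snd r))) (fst r))"

definition positive_on :: "'v scm \<Rightarrow> 'v diagram \<Rightarrow> layer \<Rightarrow> bool" where
  "positive_on M G j \<longleftrightarrow>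
     (\<forall>Z y. in_layer G j Z \<and> subscripts_in (vals M) Z \<and>
            (\<forall>r\<in>Z. y r \<in> vals M (fst r)) \<and>
            (\<forall>r\<in>Z. \<forall>s\<in>Z. reduced G r = reduced G s \<longrightarrow> y r = y s)
        \<longrightarrow> query_prob M Z y > 0)"

definition agree_on :: "'v scm \<Rightarrow> 'v scm \<Rightarrow> 'v diagram \<Rightarrow> layer \<Rightarrow> bool" where
  "agree_on M N G j \<longleftrightarrow>
     (\<forall>Z. in_layer G j Z \<and> subscripts_in (vals M) Z
        \<longrightarrow> (\<forall>y. query_prob M Z y = query_prob N Z y))"

text \<open>The two models share their domains, but the domains are not fixed beforehand; they only
  have to contain the values occurring in the subscripts of \<open>Q\<close>.\<close>

definition identifiable :: "'v diagram \<Rightarrow> layer \<Rightarrow> 'v query \<Rightarrow> bool" where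
  "identifiable G j Q \<longleftrightarrow>
     (\<forall>M N. recursive_scm M \<and> recursive_scm N \<and> compatible M G \<and> compatible N G \<and>
            (\<forall>v\<in>verts G. vals M v = vals N v) \<and> subscripts_in (vals M) Q \<and>
            positive_on M G j \<and> positive_on N G j \<and> agree_on M N G j
        \<longrightarrow> (\<forall>y. query_prob M Q y = query_prob N Q y))"

end

theory Submission
  imports Defs
begin

text \<open>For (a), a diagram can be chosen in which no subscripted variable is an ancestor of the
  response, so that the query coincides with an observational one.

  For (b), a variable \<open>T\<close> that occurs as \<open>T\<^sub>t\<close> and \<open>T\<^sub>s\<close> with \<open>t \<noteq> s\<close> can be taken such that the
  two worlds differ on a parent \<open>B\<close> of \<open>T\<close>, which is fixed to \<open>c\<close> in one of them.  Two models are
  compared that differ only in the coupling of the two responses of \<open>T\<close>, to \<open>B = c\<close> and to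
  \<open>B \<noteq> c\<close>: independent fair coins in one, the same fair coin in the other.  A query in \<open>L2_5\<close>
  evaluates \<open>T\<close> in only one way and does not see the coupling, whereas the
  descendants of \<open>T\<close> transmit both responses to the query \<open>Q\<close>.  Small independent noise on all
  variables makes the distributions positive; it is so small that the gap between the
  probabilities \<open>1/4\<close> and \<open>1/2\<close> of two silent responses survives.\<close>

subsection \<open>Solutions and ancestors\<close>

definition solution :: "'v scm \<Rightarrow> 'v subscript \<Rightarrow> (nat \<Rightarrow> nat) \<Rightarrow> 'v \<Rightarrow> nat" where
  "solution M x u = (THE s. solves M x u s)"

lemma solves_solution: "recursive_scm M \<Longrightarrow> solves M x u (solution M x u)"
  unfolding solution_def by (rule theI'[OF solves_ex1])

lemma response_solution: "response M u (Y, x) = solution M x u Y"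
  by (simp add: response_def solution_def)

lemma solution_intervened:
  "recursive_scm M \<Longrightarrow> v \<in> obs M \<Longrightarrow> x v = Some c \<Longrightarrow> solution M x u v = c"
  using solves_solution[of M x u] by (auto simp: solves_def)

lemma solution_mechanism:
  "recursive_scm M \<Longrightarrow> v \<in> obs M \<Longrightarrow> x v = None \<Longrightarrow>
    solution M x u v = mechanism M u v (solution M x u)"
  using solves_solution[of M x u] by (auto simp: solves_def)

lemma wf_parents:
  assumes "recursive_scm M"
  shows "wf {(w, v). v \<in> obs M \<and> w \<in> pa M v}"
proof (rule finite_acyclic_wf)
  have "{(w, v). v \<in> obs M \<and> w \<in> pa M v} \<subseteq> obs M \<times> obs M"
    using assms by (auto simp: recursive_scm_def)
  then show "finite {(w, v). v \<in> obs M \<and> w \<in> pa M v}"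
    using assms by (meson finite_SigmaI finite_subset recursive_scm_def)
  show "acyclic {(w, v). v \<in> obs M \<and> w \<in> pa M v}"
    using assms by (simp add: recursive_scm_def)
qed

lemma mechanism_cong:
  "(\<And>w. w \<in> pa M v \<Longrightarrow> s w = t w) \<Longrightarrow> mechanism M u v s = mechanism M u v t"
  unfolding mechanism_def by (metis restrict_ext)

text \<open>Well-founded induction along the parents, inside a set \<open>S\<close> closed under
  parents of its unintervened members. Since both the subscript and the exogenous input may change,
  it serves for dropping irrelevant subscripts as well as for varying one exogenous value.\<close>

lemma solution_eq_on:
  assumes rec: "recursive_scm M" and S: "S \<subseteq> obs M"
    and subscript: "\<And>v. v \<in> S \<Longrightarrow> x v = x' v"
    and closed: "\<And>v w. v \<in> S \<Longrightarrow> x v = None \<Longrightarrow> w \<in> pa M v \<Longrightarrow> w \<in> S"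
    and step: "\<And>v. v \<in> S \<Longrightarrow> x v = None \<Longrightarrow>
      (\<And>w. w \<in> pa M v \<Longrightarrow> solution M x u w = solution M x' u' w) \<Longrightarrow>
      mechanism M u v (solution M x u) = mechanism M u' v (solution M x' u')"
    and v: "v \<in> S"
  shows "solution M x u v = solution M x' u' v"
  using v
proof (induction v rule: wf_induct_rule[OF wf_parents[OF rec]])
  case (1 v)
  then have obs: "v \<in> obs M" using S by auto
  show ?case
  proof (cases "x v")
    case None
    have "solution M x u w = solution M x' u' w" if "w \<in> pa M v" for w
      using 1 obs that closed[OF _ None] by blast
    then show ?thesis
      using step[OF 1(2) None] None subscript[OF 1(2)] solution_mechanism[OF rec obs] by metis
  next
    case (Some c)
    then show ?thesis
      using subscript[OF 1(2)] solution_intervened[OF rec obs] by metis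
  qed
qed

section \<open>Ancestry in diagrams with edges removed\<close>

lemma ancestors_refl [simp]: "v \<in> ancestors G v"
  by (simp add: ancestors_def)

lemma ancestors_mono: "dedges H \<subseteq> dedges G \<Longrightarrow> ancestors H v \<subseteq> ancestors G v"
  unfolding ancestors_def using rtrancl_mono by blast

lemma ancestors_cut_in: "ancestors (cut_in G X) v \<subseteq> ancestors G v"
  by (rule ancestors_mono) (auto simp: cut_in_def)

lemma ancestors_cut_out: "ancestors (cut_out G X) v \<subseteq> ancestors G v"
  by (rule ancestors_mono) (auto simp: cut_out_def)

lemma ancestors_trans: "u \<in> ancestors G v \<Longrightarrow> v \<in> ancestors G w \<Longrightarrow> u \<in> ancestors G w"
  unfolding ancestors_def by auto

lemma parent_ancestor_cut_in:
  "w \<in> parents G v \<Longrightarrow> v \<notin> X \<Longrightarrow> w \<in> ancestors (cut_in G X) v"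
  unfolding ancestors_def cut_in_def parents_def by auto

lemma parent_ancestor_cut_out:
  "w \<in> parents G v \<Longrightarrow> w \<notin> X \<Longrightarrow> w \<in> ancestors (cut_out G X) v"
  unfolding ancestors_def cut_out_def parents_def by auto

lemma ancestors_in_verts:
  assumes "causal_diagram G" "v \<in> verts G"
  shows "ancestors G v \<subseteq> verts G"
proof
  fix w assume "w \<in> ancestors G v"
  then have "(w, v) \<in> (dedges G)\<^sup>*" by (simp add: ancestors_def)
  then show "w \<in> verts G"
    using assms by (induction rule: converse_rtrancl_induct) (auto simp: causal_diagram_def)
qed

text \<open>The ancestors of \<open>Y\<close> in the overlined diagram contain all parents of their
  unintervened members, so values of \<open>x\<close> elsewhere never enter the computation of
  \<open>Y\<close>.\<close>

lemma solution_reduced: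
  assumes "recursive_scm M" "compatible M G" "causal_diagram G" "Y \<in> verts G"
  shows "solution M x u Y = solution M (x |` ancestors (cut_in G (dom x)) Y) u Y"
proof (rule solution_eq_on[where S = "ancestors (cut_in G (dom x)) Y"])
  let ?S = "ancestors (cut_in G (dom x)) Y"
  show sub: "?S \<subseteq> obs M"
    using ancestors_cut_in ancestors_in_verts[OF assms(3,4)] assms(2)
    unfolding compatible_def by fast
  show "w \<in> ?S" if "v \<in> ?S" "x v = None" "w \<in> pa M v" for v w
  proof -
    have "w \<in> parents G v"
      using that sub assms(2) unfolding compatible_def by blast
    then show ?thesis
      using that(1,2) by (meson ancestors_trans domIff parent_ancestor_cut_in)
  qed
qed (use assms in \<open>auto intro: mechanism_cong\<close>)

subsection \<open>Identification in sparse diagrams\<close>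

text \<open>Every potential response in \<open>Q\<close> equals its variable without subscript, so
  \<open>Q\<close> amounts to an observational distribution, and those belong to every
  layer.\<close>

lemma identifiable_no_subscripted_ancestor:
  assumes G: "causal_diagram G" and Q: "query_over (verts G) Q"
    and disj: "\<And>Y x. (Y, x) \<in> Q \<Longrightarrow> dom x \<inter> ancestors G Y = {}"
  shows "identifiable G j Q"
  unfolding identifiable_def
proof safe
  fix M N y
  assume M: "recursive_scm M" "compatible M G" and N: "recursive_scm N" "compatible N G"
    and agree: "agree_on M N G j"
  let ?Z = "(\<lambda>r. (fst r, Map.empty)) ` Q :: 'a query"
  have plain: "response K u r = response K u (fst r, Map.empty)"
    if "recursive_scm K" "compatible K G" "r \<in> Q" for K u r
  proof -
    obtain Y x where r: "r = (Y, x)" by (cases r)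
    have Y: "Y \<in> verts G" using Q that r by (auto simp: query_over_def)
    have "x |` ancestors (cut_in G (dom x)) Y = Map.empty"
      using disj[of Y x] that r ancestors_cut_in[of G "dom x" Y]
      by (fastforce simp: restrict_map_def)
    then show ?thesis
      using solution_reduced[OF that(1,2) G Y, of x u] r by (simp add: response_solution)
  qed
  show "query_prob M Q y = query_prob N Q y"
  \<comment> \<open>Distinct members of \<open>Q\<close> may collapse to one variable; value vectors
    that disagree there have probability 0 in both models.\<close>
  proof (cases "\<forall>r\<in>Q. \<forall>s\<in>Q. fst r = fst s \<longrightarrow> y r = y s")
    case True
    define z where "z q = y (SOME r. r \<in> Q \<and> fst r = fst q)" for q :: "'a response"
    have z: "z (fst r, Map.empty) = y r" if "r \<in> Q" for r
    proof -
      let ?s = "SOME s. s \<in> Q \<and> fst s = fst r"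
      have "?s \<in> Q \<and> fst ?s = fst r"
        by (rule someI[of _ r]) (use that in auto)
      then have "y ?s = y r"
        using True that by blast
      then show ?thesis
        by (simp add: z_def)
    qed
    have eq: "query_prob K Q y = query_prob K ?Z z" if "recursive_scm K" "compatible K G" for K
    proof -
      have "(\<forall>r\<in>Q. response K u r = y r) \<longleftrightarrow> (\<forall>q\<in>?Z. response K u q = z q)" for u
        using plain[OF that] z by (simp cong: ball_cong)
      then show ?thesis by (simp add: query_prob_def)
    qed
    have "query_over (verts G) ?Z"
      using Q by (auto simp: query_over_def)
    moreover have "layer_condition G j ?Z"
      by (cases j) (auto simp: ctf_ancestors_def intro: exI[of _ Map.empty])
    moreover have "subscripts_in (vals M) ?Z"
      by (auto simp: subscripts_in_def)
    ultimately have "query_prob M ?Z z = query_prob N ?Z z"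
      using agree by (auto simp: agree_on_def in_layer_def)
    then show ?thesis
      using eq[OF M] eq[OF N] by simp
  next
    case False
    then obtain r s where rs: "r \<in> Q" "s \<in> Q" "fst r = fst s" "y r \<noteq> y s"
      by blast
    have "query_prob K Q y = 0" if "recursive_scm K" "compatible K G" for K
    proof -
      have "{u. \<forall>r\<in>Q. response K u r = y r} = {}"
        using plain[OF that rs(1)] plain[OF that rs(2)] rs by (metis (mono_tags, lifting) empty_Collect_eq)
      then show ?thesis
        unfolding query_prob_def by (metis measure_empty)
    qed
    then show ?thesis
      using M N by simp
  qed
qed

lemma ball_pair: "(\<forall>(a, b)\<in>S. P a b) \<longleftrightarrow> (\<forall>a b. (a, b) \<in> S \<longrightarrow> P a b)"
  by auto

lemma ctf_ancestors_iff:
  "(W, w) \<in> ctf_ancestors G Q \<longleftrightarrow>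
     (\<exists>Y x. (Y, x) \<in> Q \<and> W \<in> ancestors (cut_out G (dom x)) Y \<and>
        w = x |` ancestors (cut_in G (dom x)) W)"
  by (auto simp: ctf_ancestors_def)

lemma L2_5_no_subscripted_ancestor:
  assumes "\<And>Y x. (Y, x) \<in> Q \<Longrightarrow> dom x \<inter> ancestors G Y = {}"
  shows "layer_condition G L2_5 Q"
proof -
  have "w = Map.empty" if W: "(W, w) \<in> ctf_ancestors G Q" for W w
  proof -
    obtain Y x where Yx: "(Y, x) \<in> Q" "W \<in> ancestors (cut_out G (dom x)) Y"
      "w = x |` ancestors (cut_in G (dom x)) W"
      using W by (auto simp: ctf_ancestors_iff)
    have "ancestors (cut_in G (dom x)) W \<subseteq> ancestors G Y"
      using Yx(2) ancestors_cut_in ancestors_cut_out ancestors_trans by (metis subset_eq)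
    then show ?thesis
      using assms[OF Yx(1)] unfolding Yx(3) restrict_map_def by fastforce
  qed
  then show ?thesis
    unfolding layer_condition.simps ball_pair by metis
qed

section \<open>Layers below \<open>L2_5\<close>\<close>

lemma L1_imp_L2: "in_layer G L1 Q \<Longrightarrow> in_layer G L2 Q"
  by (auto simp: in_layer_def)

text \<open>The part of the \<open>L2_25\<close> condition that does not mention the diagram; it
  survives any change of edges.\<close>

definition compatible_subscripts :: "'v query \<Rightarrow> 'v subscript \<Rightarrow> bool" where
  "compatible_subscripts Q x \<longleftrightarrow>
     (\<forall>V v W w. (V, v) \<in> Q \<longrightarrow> (W, w) \<in> Q \<longrightarrow> V = W \<longrightarrow> v = w) \<and>
     (\<forall>V v. (V, v) \<in> Q \<longrightarrow> v \<subseteq>\<^sub>m x \<and> V \<notin> dom v)"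

lemma L2_25_iff:
  "layer_condition G L2_25 Q \<longleftrightarrow>
     (\<exists>x. dom x \<subseteq> verts G \<and> compatible_subscripts Q x \<and>
        (\<forall>V v A. (V, v) \<in> Q \<longrightarrow> A \<in> dom x - {V} \<longrightarrow>
           A \<in> ancestors (cut_in G (dom x - {V})) V \<longrightarrow> A \<in> dom v))"
proof -
  have dom: "(\<exists>X\<subseteq>verts G. \<exists>x. dom x = X \<and> P X x) \<longleftrightarrow> (\<exists>x. dom x \<subseteq> verts G \<and> P (dom x) x)"
    for P :: "'a set \<Rightarrow> 'a subscript \<Rightarrow> bool"
    by auto
  have "(\<forall>(V, v)\<in>Q. v \<subseteq>\<^sub>m x \<and> V \<notin> dom v \<and> (\<forall>A\<in>dom x - {V}. R A V \<longrightarrow> A \<in> dom v)) \<longleftrightarrow>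
      (\<forall>V v. (V, v) \<in> Q \<longrightarrow> v \<subseteq>\<^sub>m x \<and> V \<notin> dom v) \<and>
      (\<forall>V v A. (V, v) \<in> Q \<longrightarrow> A \<in> dom x - {V} \<longrightarrow> R A V \<longrightarrow> A \<in> dom v)"
    for x :: "'a subscript" and R
    unfolding ball_pair by metis
  then show ?thesis
    unfolding layer_condition.simps dom compatible_subscripts_def ball_pair by simp
qed

lemma L2_imp_L2_25:
  assumes "in_layer G L2 Q"
  shows "in_layer G L2_25 Q"
proof -
  obtain z where z: "\<forall>(Y, x)\<in>Q. x = z" and Q: "query_over (verts G) Q"
    using assms by (auto simp: in_layer_def)
  show ?thesis
  \<comment> \<open>For the empty query \<open>z\<close> is arbitrary and might leave the vertex
    set.\<close>
  proof (cases "Q = {}")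
    case True
    then show ?thesis using Q by (auto simp: in_layer_def)
  next
    case False
    then have "dom z \<subseteq> verts G" using z Q by (fastforce simp: query_over_def)
    moreover have "V = W \<longrightarrow> v = w" if "(V, v) \<in> Q" "(W, w) \<in> Q" for V v W w
      using z that unfolding ball_pair by metis
    moreover have "v = z \<and> V \<notin> dom v" if "(V, v) \<in> Q" for V v
      using z Q that unfolding query_over_def by auto
    ultimately have "layer_condition G L2_25 Q"
      unfolding L2_25_iff compatible_subscripts_def by (intro exI[of _ z]) auto
    then show ?thesis
      using Q by (simp add: in_layer_def)
  qed
qed

lemma all_layer: "(\<forall>k. P k) \<longleftrightarrow> P L1 \<and> P L2 \<and> P L2_25 \<and> P L2_5 \<and> P L3"
  by (metis layer.exhaust)

text \<open>The inclusions among \<open>L1\<close>, \<open>L2\<close> and \<open>L2_25\<close>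
  reduce the exclusion of all lower layers to that of the next lower one.\<close>

lemma exactly_in_layer_simps:
  "exactly_in_layer G L2 Q \<longleftrightarrow> in_layer G L2 Q \<and> \<not> in_layer G L1 Q"
  "exactly_in_layer G L2_25 Q \<longleftrightarrow> in_layer G L2_25 Q \<and> \<not> in_layer G L2 Q"
  "exactly_in_layer G L2_5 Q \<longleftrightarrow> in_layer G L2_5 Q \<and> \<not> in_layer G L2_25 Q"
  using L1_imp_L2[of G Q] L2_imp_L2_25[of G Q]
  unfolding exactly_in_layer_def all_layer by auto

lemma not_L2_25_witness:
  assumes "\<not> layer_condition G L2_25 Q" "dom x \<subseteq> verts G" "compatible_subscripts Q x"
  shows "\<exists>V v A. (V, v) \<in> Q \<and> A \<in> dom x - {V} \<and> A \<notin> dom v"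
  using assms unfolding L2_25_iff by blast

text \<open>Removing edges removes ancestors and so weakens the ancestor clause.\<close>

lemma L2_25_condition_mono:
  assumes "layer_condition G L2_25 Q" "verts H = verts G" "dedges H \<subseteq> dedges G"
  shows "layer_condition H L2_25 Q"
proof -
  have "A \<in> ancestors (cut_in G X) v" if "A \<in> ancestors (cut_in H X) v" for A X v
    using that assms(3) ancestors_mono[of "cut_in H X" "cut_in G X"] by (auto simp: cut_in_def)
  then show ?thesis
    using assms(1,2) unfolding L2_25_iff by metis
qed

text \<open>For \<open>L2\<close> and \<open>L2_25\<close>, and for a query that violates \<open>L2_25\<close> in every diagram, the edgeless
  diagram does, since there \<open>Y\<^sub>x\<close> equals \<open>Y\<close>.  Otherwise the violation comes from some \<open>A\<close>
  subscripted in the query but not in its only response of some \<open>B\<close>; then the single edge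
  \<open>A \<rightarrow> B\<close> keeps the query out of \<open>L2_25\<close>, and still \<open>Y\<^sub>x\<close> equals \<open>Y\<close> throughout the query.\<close>

lemma exists_identifying_diagram:
  assumes G: "causal_diagram G" and Q: "exactly_in_layer G i Q" and i: "i \<in> {L2, L2_25, L2_5}"
  shows "\<exists>H. causal_diagram H \<and> verts H = verts G \<and> exactly_in_layer H i Q \<and> identifiable H j Q"
proof -
  have over: "query_over (verts G) Q"
    using Q by (auto simp: exactly_in_layer_def in_layer_def)
  have fin: "finite (verts G)"
    using G by (simp add: causal_diagram_def)
  have "\<exists>H. causal_diagram H \<and> verts H = verts G \<and> exactly_in_layer H i Q \<and>
          (\<forall>Y x. (Y, x) \<in> Q \<longrightarrow> dom x \<inter> ancestors H Y = {})"
  proof (cases "i = L2_5 \<and> (\<exists>x. dom x \<subseteq> verts G \<and> compatible_subscripts Q x)")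
    case False
    let ?H = "\<lparr>verts = verts G, dedges = {}, bedges = {}\<rparr> :: 'a diagram"
    have H: "causal_diagram ?H"
      using fin by (simp add: causal_diagram_def acyclic_def irrefl_def sym_def)
    have disj: "dom x \<inter> ancestors ?H Y = {}" if "(Y, x) \<in> Q" for Y x
      using over that by (auto simp: ancestors_def query_over_def)
    have L25: "layer_condition ?H L2_5 Q"
      using disj by (rule L2_5_no_subscripted_ancestor)
    have "exactly_in_layer ?H i Q"
    proof (cases "i = L2_5")
      case True
      then have "\<not> layer_condition ?H L2_25 Q"
        using False unfolding L2_25_iff by auto
      then show ?thesis
        using True over L25
        by (simp add: exactly_in_layer_simps in_layer_def del: layer_condition.simps)
    next
      case False
      have low: "layer_condition ?H L1 Q = layer_condition G L1 Q"
          "layer_condition ?H L2 Q = layer_condition G L2 Q"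
        by (simp_all only: layer_condition.simps)
      from False consider "i = L2" | "i = L2_25" using i by auto
      then show ?thesis
      proof cases
        case 1
        then show ?thesis
          using Q low
          by (simp add: exactly_in_layer_simps in_layer_def del: layer_condition.simps)
      next
        case 2
        have "layer_condition ?H L2_25 Q"
          by (rule L2_25_condition_mono[of G]) (use 2 Q in \<open>simp_all add: exactly_in_layer_simps in_layer_def del: layer_condition.simps\<close>)
        then show ?thesis
          using 2 Q low
          by (simp add: exactly_in_layer_simps in_layer_def del: layer_condition.simps)
      qed
    qed
    then show ?thesis
      using H disj by (intro exI[of _ ?H]) auto
  next
    case True
    then obtain x where x: "dom x \<subseteq> verts G" "compatible_subscripts Q x" by auto
    \<comment> \<open>Trimming \<open>x\<close> to the variables subscripted somewhere in
      \<open>Q\<close> ensures that the witness \<open>A\<close> occurs in a subscript, hence in the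
      domain of every other vector compatible with \<open>Q\<close>.\<close>
    define D where "D = (\<Union>(V, v)\<in>Q. dom v)"
    have sub: "dom v \<subseteq> D" if "(V, v) \<in> Q" for V v
      using that by (auto simp: D_def)
    have "dom v \<subseteq> dom x" if "(V, v) \<in> Q" for V v
      using x(2) that map_le_implies_dom_le unfolding compatible_subscripts_def by metis
    then have "D \<subseteq> dom x"
      unfolding D_def by blast
    then have D: "dom (x |` D) = D"
      by auto
    have "v \<subseteq>\<^sub>m x |` D" if "(V, v) \<in> Q" for V v
      using x(2) that sub[OF that] unfolding compatible_subscripts_def map_le_def
      by (metis restrict_in subsetD)
    then have "compatible_subscripts Q (x |` D)"
      using x(2) unfolding compatible_subscripts_def by metis
    moreover have "\<not> layer_condition G L2_25 Q"
      using Q True over by (simp add: exactly_in_layer_simps in_layer_def del: layer_condition.simps)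
    moreover have "D \<subseteq> verts G"
      using over unfolding D_def query_over_def ball_pair by blast
    ultimately obtain B b A where B: "(B, b) \<in> Q" "A \<in> D - {B}" "A \<notin> dom b"
      using not_L2_25_witness[of G Q "x |` D"] unfolding D by blast
    let ?H = "\<lparr>verts = verts G, dedges = {(A, B)}, bedges = {}\<rparr> :: 'a diagram"
    have AB: "A \<noteq> B" "A \<in> verts G" "B \<in> verts G"
      using B over \<open>D \<subseteq> verts G\<close> unfolding query_over_def ball_pair by blast+
    have H: "causal_diagram ?H"
      using fin AB by (auto simp: causal_diagram_def acyclic_def irrefl_def sym_def trancl_insert)
    have anc: "W = Y \<or> Y = B \<and> W = A" if "W \<in> ancestors ?H Y" for W Y
    proof -
      have "(W, Y) \<in> {(A, B)}\<^sup>*" using that by (simp add: ancestors_def)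
      then show ?thesis by (induction rule: rtrancl_induct) (use AB(1) in auto)
    qed
    \<comment> \<open>Only \<open>B\<close> has a proper ancestor here, namely \<open>A\<close>, and
      \<open>b\<close> is the only subscript of \<open>B\<close> in \<open>Q\<close>.\<close>
    have disj: "dom y \<inter> ancestors ?H Y = {}" if "(Y, y) \<in> Q" for Y y
    proof -
      have "Y \<notin> dom y" using over that unfolding query_over_def ball_pair by blast
      moreover have "A \<notin> dom y" if "Y = B"
        using B(1,3) that \<open>(Y, y) \<in> Q\<close> x(2) unfolding compatible_subscripts_def by metis
      ultimately show ?thesis using anc by blast
    qed
    have L25: "layer_condition ?H L2_5 Q"
      using disj by (rule L2_5_no_subscripted_ancestor)
    have "\<not> layer_condition ?H L2_25 Q"
    proof
      assume "layer_condition ?H L2_25 Q"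
      then obtain z where z: "compatible_subscripts Q z"
        "A \<in> dom z - {B} \<Longrightarrow> A \<in> ancestors (cut_in ?H (dom z - {B})) B \<Longrightarrow> A \<in> dom b"
        using B(1) unfolding L2_25_iff by blast
      have "A \<in> dom z"
        using B(2) z(1) map_le_implies_dom_le unfolding D_def compatible_subscripts_def by blast
      moreover have "A \<in> ancestors (cut_in ?H (dom z - {B})) B"
        by (rule parent_ancestor_cut_in) (auto simp: parents_def)
      ultimately show False using z(2) AB(1) B(3) by blast
    qed
    then have "exactly_in_layer ?H i Q"
      using True over L25
      by (simp add: exactly_in_layer_simps in_layer_def del: layer_condition.simps)
    then show ?thesis
      using H disj by (intro exI[of _ ?H]) auto
  qed
  then show ?thesis
    using over identifiable_no_subscripted_ancestor by metis
qed

subsection \<open>Conflicting subscripts\<close>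

lemma map_eqI:
  assumes "\<And>A a. f A = Some a \<longleftrightarrow> g A = Some a"
  shows "f = g"
proof
  fix A show "f A = g A"
    using assms[of A] by (cases "g A") auto
qed

lemma ancestors_antisym:
  assumes "causal_diagram G" "u \<in> ancestors G v" "v \<in> ancestors G u"
  shows "u = v"
  using assms acyclic_impl_antisym_rtrancl[of "dedges G"]
  by (auto simp: ancestors_def causal_diagram_def dest: antisymD)

lemma ancestors_cut_in_mono: "X \<subseteq> Z \<Longrightarrow> ancestors (cut_in G Z) v \<subseteq> ancestors (cut_in G X) v"
  by (rule ancestors_mono) (auto simp: cut_in_def)

lemma ancestors_cut_in_induct [consumes 1, case_names refl step]:
  assumes "u \<in> ancestors (cut_in G X) v"
    and "P v"
    and "\<And>a b. (a, b) \<in> dedges G \<Longrightarrow> b \<notin> X \<Longrightarrow> b \<in> ancestors (cut_in G X) v \<Longrightarrow> P b \<Longrightarrow> P a"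
  shows "P u"
proof -
  have "(u, v) \<in> (dedges (cut_in G X))\<^sup>*"
    using assms(1) by (simp add: ancestors_def)
  then show ?thesis
    by (induction rule: converse_rtrancl_induct)
       (use assms(2,3) in \<open>auto simp: cut_in_def ancestors_def\<close>)
qed

lemma ancestors_cut_out_induct [consumes 1, case_names refl step]:
  assumes "u \<in> ancestors (cut_out G X) v"
    and "P v"
    and "\<And>a b. (a, b) \<in> dedges G \<Longrightarrow> a \<notin> X \<Longrightarrow> b \<in> ancestors (cut_out G X) v \<Longrightarrow> P b \<Longrightarrow> P a"
  shows "P u"
proof -
  have "(u, v) \<in> (dedges (cut_out G X))\<^sup>*"
    using assms(1) by (simp add: ancestors_def)
  then show ?thesis
    by (induction rule: converse_rtrancl_induct)
       (use assms(2,3) in \<open>auto simp: cut_out_def ancestors_def\<close>)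
qed

lemma edge_ancestor_cut_in:
  assumes "(a, b) \<in> dedges G" "b \<notin> X" "b \<in> ancestors (cut_in G X) v"
  shows "a \<in> ancestors (cut_in G X) v"
proof -
  have "a \<in> ancestors (cut_in G X) b"
    using assms(1,2) by (intro parent_ancestor_cut_in) (simp_all add: parents_def)
  then show ?thesis
    using assms(3) by (rule ancestors_trans)
qed

lemma edge_ancestor_cut_out:
  assumes "(a, b) \<in> dedges G" "a \<notin> X" "b \<in> ancestors (cut_out G X) v"
  shows "a \<in> ancestors (cut_out G X) v"
proof -
  have "a \<in> ancestors (cut_out G X) b"
    using assms(1,2) by (intro parent_ancestor_cut_out) (simp_all add: parents_def)
  then show ?thesis
    using assms(3) by (rule ancestors_trans)
qed

text \<open>Let \<open>T\<close> be a counterfactual ancestor of responses of two different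
  variables. The ancestor clause keeps \<open>T\<close> and the paths by which subscripts reach it
  clear of \<open>dom x\<close>, so both reduced subscripts of \<open>T\<close> are \<open>x\<close>
  restricted to the ancestors of \<open>T\<close> with \<open>dom x\<close> overlined.\<close>

lemma L2_25_imp_L2_5:
  assumes G: "causal_diagram G" and Q: "in_layer G L2_25 Q"
  shows "in_layer G L2_5 Q"
proof -
  obtain x where over: "query_over (verts G) Q" and cs: "compatible_subscripts Q x"
    and incl: "\<And>V v A. (V, v) \<in> Q \<Longrightarrow> A \<in> dom x - {V} \<Longrightarrow>
                  A \<in> ancestors (cut_in G (dom x - {V})) V \<Longrightarrow> A \<in> dom v"
    using Q unfolding in_layer_def L2_25_iff by metis
  \<comment> \<open>Going backwards from \<open>V\<close>, a vertex of \<open>dom x\<close> other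
    than \<open>V\<close> would belong to \<open>dom v\<close> by the ancestor clause, but the edges
    out of \<open>dom v\<close> are removed.\<close>
  have outside: "T \<in> ancestors (cut_in G (dom x - {V})) V \<and> (T \<in> dom x \<longrightarrow> T = V)"
    if "T \<in> ancestors (cut_out G (dom v)) V" "(V, v) \<in> Q" for T V v
    using that(1)
  proof (induction rule: ancestors_cut_out_induct)
    case (step S T)
    then have "S \<in> ancestors (cut_in G (dom x - {V})) V"
      by (blast intro: edge_ancestor_cut_in)
    then show ?case
      using incl[OF that(2)] step by blast
  qed simp
  have half: "(w |` ancestors (cut_in G (dom w)) T) A = Some a"
    if V: "(V, v) \<in> Q" "T \<in> ancestors (cut_out G (dom v)) V"
      and W: "(W, w) \<in> Q" "T \<in> ancestors (cut_out G (dom w)) W"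
      and A: "(v |` ancestors (cut_in G (dom v)) T) A = Some a" for V v W w T A a
  proof (cases "V = W")
    case True
    then show ?thesis
      using cs V W A unfolding compatible_subscripts_def by metis
  next
    case False
    have T: "T \<notin> dom x"
      using outside[OF V(2,1)] outside[OF W(2,1)] False by blast
    have TV: "T \<in> ancestors G V" "T \<in> ancestors G W"
      using V(2) W(2) ancestors_cut_out by (metis subsetD)+
    have v: "v A = Some a" "A \<in> ancestors (cut_in G (dom v)) T"
      using A by (auto simp: restrict_map_def split: if_splits)
    \<comment> \<open>A vertex of \<open>dom x\<close> strictly after \<open>A\<close> on the path
      to \<open>T\<close> would differ from \<open>V\<close> by acyclicity, hence lie in
      \<open>dom v\<close>, whose incoming edges are removed.\<close>
    have "A \<in> ancestors (cut_in G (dom x)) T \<and> A \<in> ancestors (cut_in G (dom x - {V})) V"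
      using v(2)
    proof (induction rule: ancestors_cut_in_induct)
      case refl
      then show ?case using outside[OF V(2,1)] by simp
    next
      case (step B S)
      have "S \<in> ancestors G T"
        using step ancestors_cut_in by fast
      then have "S \<notin> dom x"
        using incl[OF V(1), of S] step T TV(1) ancestors_antisym[OF G, of S T] by blast
      then show ?case
        using step by (blast intro: edge_ancestor_cut_in)
    qed
    then have anc: "A \<in> ancestors (cut_in G (dom x)) T" by simp
    have "v \<subseteq>\<^sub>m x" "w \<subseteq>\<^sub>m x"
      using cs V W unfolding compatible_subscripts_def by metis+
    then have Ax: "x A = Some a" and w: "dom w \<subseteq> dom x"
      using v(1) by (metis domI map_le_def) (rule map_le_implies_dom_le, fact)
    have "A \<noteq> W"
      using T Ax anc ancestors_cut_in[of G "dom x" T] TV(2) ancestors_antisym[OF G, of T W] by blast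
    moreover have "A \<in> ancestors (cut_in G (dom x - {W})) W"
      using anc outside[OF W(2,1)] ancestors_cut_in_mono[of "dom x - {W}" "dom x" G T]
      by (blast intro: ancestors_trans)
    ultimately have "A \<in> dom w"
      using incl[OF W(1)] Ax by blast
    then have "w A = Some a"
      using \<open>w \<subseteq>\<^sub>m x\<close> Ax by (metis map_le_def)
    moreover have "A \<in> ancestors (cut_in G (dom w)) T"
      using anc ancestors_cut_in_mono[OF w] by blast
    ultimately show ?thesis by simp
  qed
  have "v |` ancestors (cut_in G (dom v)) T = w |` ancestors (cut_in G (dom w)) T"
    if "(V, v) \<in> Q" "T \<in> ancestors (cut_out G (dom v)) V"
      "(W, w) \<in> Q" "T \<in> ancestors (cut_out G (dom w)) W" for V v W w T
    by (rule map_eqI) (use half[OF that] half[OF that(3,4,1,2)] in blast)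
  then show ?thesis
    using over unfolding in_layer_def layer_condition.simps ball_pair ctf_ancestors_iff by metis
qed

text \<open>Split a path at its last edge, from \<open>B\<close> to \<open>T\<close>: an intervened
  parent has no incoming edge and contributes only its own value, any other parent its whole reduced
  subscript.\<close>

lemma reduced_subscript_parents:
  assumes "x T = None"
  shows "(x |` ancestors (cut_in G (dom x)) T) A = Some a \<longleftrightarrow>
    (\<exists>B. (B, T) \<in> dedges G \<and>
      (if x B = None then (x |` ancestors (cut_in G (dom x)) B) A = Some a
       else A = B \<and> x B = Some a))"
    (is "?L \<longleftrightarrow> (\<exists>B. ?R B)")
proof
  assume ?L
  then have A: "x A = Some a" "A \<in> ancestors (cut_in G (dom x)) T"
    by (auto simp: restrict_map_def split: if_splits)
  then have "(A, T) \<in> (dedges (cut_in G (dom x)))\<^sup>*" "A \<noteq> T"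
    using assms by (auto simp: ancestors_def)
  then obtain B where B: "A \<in> ancestors (cut_in G (dom x)) B" "(B, T) \<in> dedges G"
    by (auto elim: rtranclE simp: ancestors_def cut_in_def)
  have "A = B" if "x B \<noteq> None"
    using B(1) that by (auto elim: rtranclE simp: ancestors_def cut_in_def)
  then show "\<exists>B. ?R B"
    using B A(1) by (intro exI[of _ B]) auto
next
  assume "\<exists>B. ?R B"
  then obtain B where B: "?R B" ..
  then have "B \<in> ancestors (cut_in G (dom x)) T"
    using assms by (intro parent_ancestor_cut_in) (auto simp: parents_def)
  then have "A \<in> ancestors (cut_in G (dom x)) T \<and> x A = Some a"
    using B by (auto simp: restrict_map_def split: if_splits dest: ancestors_trans)
  then show ?L by simp
qed

text \<open>A variable that occurs with two different subscripts, minimal with respect to ancestry, has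
  a parent on which the two subscripts themselves differ.\<close>

lemma not_L2_5_witness:
  assumes G: "causal_diagram G" and over: "query_over (verts G) Q"
    and Q: "\<not> layer_condition G L2_5 Q"
  obtains Y x Y' x' T B c where "(Y, x) \<in> Q" "(Y', x') \<in> Q"
    "T \<in> ancestors (cut_out G (dom x)) Y" "T \<in> ancestors (cut_out G (dom x')) Y'"
    "(B, T) \<in> dedges G" "x B = Some c" "x' B \<noteq> Some c"
proof -
  let ?red = "\<lambda>x T. x |` ancestors (cut_in G (dom x)) T"
  obtain Y x Y' x' S where YQ: "(Y, x) \<in> Q" "(Y', x') \<in> Q"
    and S: "S \<in> ancestors (cut_out G (dom x)) Y" "S \<in> ancestors (cut_out G (dom x')) Y'"
      "?red x S \<noteq> ?red x' S"
    using Q unfolding layer_condition.simps ball_pair ctf_ancestors_iff by metis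
  define C where "C = {T. T \<in> ancestors (cut_out G (dom x)) Y \<and>
    T \<in> ancestors (cut_out G (dom x')) Y' \<and> ?red x T \<noteq> ?red x' T}"
  have "wf (dedges G)"
    using G unfolding causal_diagram_def
    by (metis finite_SigmaI finite_acyclic_wf finite_subset)
  moreover have "S \<in> C" using S by (simp add: C_def)
  ultimately obtain T where T: "T \<in> C" and min: "\<And>B. (B, T) \<in> dedges G \<Longrightarrow> B \<notin> C"
    by (metis wfE_min)
  have none: "x T = None" if "T \<in> ancestors (cut_out G (dom x)) Y" "(Y, x) \<in> Q" for x Y
    using that(1)
  proof (induction rule: ancestors_cut_out_induct)
    case refl
    show ?case using over that(2) unfolding query_over_def ball_pair by blast
  qed auto
  have TY: "T \<in> ancestors (cut_out G (dom x)) Y" "T \<in> ancestors (cut_out G (dom x')) Y'"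
    using T by (auto simp: C_def)
  have "\<exists>B. (B, T) \<in> dedges G \<and> x B \<noteq> x' B"
  proof (rule ccontr)
    assume *: "\<not> ?thesis"
    have same: "x' B = x B" if "(B, T) \<in> dedges G" for B
      using * that by metis
    \<comment> \<open>An unsubscripted parent is again a counterfactual ancestor of both responses,
      so minimality of \<open>T\<close> makes its two reduced subscripts equal.\<close>
    have par: "(if x B = None then ?red x B A = Some a else A = B \<and> x B = Some a) \<longleftrightarrow>
        (if x' B = None then ?red x' B A = Some a else A = B \<and> x' B = Some a)"
      if B: "(B, T) \<in> dedges G" for A B a
    proof (cases "x B")
      case None
      then have "B \<notin> dom x" "B \<notin> dom x'"
        using same[OF B] by auto
      then have "?red x B = ?red x' B"
        using min[OF B] edge_ancestor_cut_out[OF B _ TY(1)] edge_ancestor_cut_out[OF B _ TY(2)]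
        unfolding C_def by simp
      then show ?thesis
        using None same[OF B] by simp
    next
      case (Some b)
      then show ?thesis
        using same[OF B] by simp
    qed
    have "?red x T A = Some a \<longleftrightarrow> ?red x' T A = Some a" for A a
      unfolding reduced_subscript_parents[of x T, OF none[OF TY(1) YQ(1)]]
        reduced_subscript_parents[of x' T, OF none[OF TY(2) YQ(2)]]
      by (rule ex_cong1, rule conj_cong[OF refl], rule par)
    then have "?red x T = ?red x' T"
      by (rule map_eqI)
    then show False using T by (simp add: C_def)
  qed
  then obtain B where B: "(B, T) \<in> dedges G" "x B \<noteq> x' B" by blast
  show thesis
  proof (cases "x B")
    case (Some c)
    then show thesis
      using that[OF YQ TY B(1)] B(2) by simp
  next
    case None
    then obtain c where "x' B = Some c"
      using B(2) by (cases "x' B") auto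
    then show thesis
      using that[OF YQ(2,1) TY(2,1) B(1)] None by simp
  qed
qed

subsection \<open>Models with coupled responses\<close>

text \<open>Opens event probabilities to the calculus of \<open>map_pmf\<close> and
  \<open>bind_pmf\<close>.\<close>

lemma measure_pmf_as_pmf: "measure_pmf.prob P A = pmf (map_pmf (\<lambda>x. x \<in> A) P) True"
  by (simp add: pmf_map vimage_def)

text \<open>Subscripts are below \<open>m\<close>.  Without noise, every variable takes the default value \<open>m\<close> or
  the signal value \<open>m + 1\<close>, so neither can be produced by an intervention.  The exogenous value of
  a variable is at most \<open>m + 1\<close> if there is noise, which it then copies; the other values of the one of \<open>T\<close>
  encode two bits.  The first bit decides whether \<open>T\<close> signals when \<open>B\<close> has the value \<open>c\<close>, the
  second one when it has another value.  Only children of signalling variables pass the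
  signal on.\<close>

locale clash =
  fixes G :: "'v diagram" and T B :: 'v and c m :: nat and e :: "'v \<Rightarrow> nat" and \<delta> :: real
  assumes diagram: "causal_diagram G" and edge: "(B, T) \<in> dedges G"
    and e: "inj_on e (verts G)" and \<delta>: "0 < \<delta>" "\<delta> < 1" and c: "c < m"
begin

definition signal :: "bool \<Rightarrow> nat" where
  "signal b = (if b then m + 1 else m)"

text \<open>The codes \<open>m + 2\<close> to \<open>m + 5\<close> lie above the noise values
  \<open>{..m + 1}\<close>, so noise and code cannot be confused.\<close>

definition encode :: "bool \<times> bool \<Rightarrow> nat" where
  "encode b = m + 2 + of_bool (fst b) + 2 * of_bool (snd b)"

text \<open>\<open>\<beta>\<close> tells whether \<open>B\<close> has the value \<open>c\<close>;
  the two sets list the codes whose first, respectively second, bit is set.\<close>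

definition decode :: "bool \<Rightarrow> nat \<Rightarrow> nat" where
  "decode \<beta> k = (if k \<le> m + 1 then k else signal (k \<in> (if \<beta> then {m + 3, m + 5} else {m + 4, m + 5})))"

definition noisy :: "(bool \<times> bool) pmf \<Rightarrow> nat pmf" where
  "noisy p = bind_pmf (bernoulli_pmf \<delta>) (\<lambda>b. if b then pmf_of_set {..m + 1} else map_pmf encode p)"

definition update :: "'v \<Rightarrow> ('v \<Rightarrow> nat) \<Rightarrow> (nat \<Rightarrow> nat) \<Rightarrow> nat" where
  "update v s u =
     (if v = T then decode (s B = c) (u (e T))
      else if u (e v) \<le> m + 1 then u (e v)
      else signal (\<exists>w\<in>parents G v. s w = m + 1))"

definition coins :: "(bool \<times> bool) pmf" where
  "coins = pair_pmf (bernoulli_pmf (1/2)) (bernoulli_pmf (1/2))"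

text \<open>Same fair marginals as \<open>coins\<close>, but both bits are clear with probability
  1/2 instead of 1/4.\<close>

definition tied :: "(bool \<times> bool) pmf" where
  "tied = map_pmf (\<lambda>b. (b, b)) (bernoulli_pmf (1/2))"

text \<open>Each variable has a private exogenous coordinate. Away from \<open>T\<close> all codes
  act alike: there it only matters whether the coordinate is noisy.\<close>

definition model :: "(bool \<times> bool) pmf \<Rightarrow> 'v scm" where
  "model p = \<lparr>obs = verts G, vals = \<lambda>_. {..m + 1}, pa = parents G, exo = \<lambda>v. {e v},
     fn = update, pu = Pi_pmf (e ` verts G) 0 (\<lambda>i. noisy (if i = e T then p else coins))\<rparr>"

lemma model_simps [simp]:
  "obs (model p) = verts G" "vals (model p) v = {..m + 1}" "pa (model p) = parents G"
  "exo (model p) v = {e v}"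
  by (simp_all add: model_def)

lemma finite_verts [simp]: "finite (verts G)"
  using diagram by (simp add: causal_diagram_def)

lemma T_vert: "T \<in> verts G" and B_vert: "B \<in> verts G" and B_neq_T: "B \<noteq> T"
  using diagram edge by (auto simp: causal_diagram_def acyclic_def)

lemma mechanism_model [simp]: "mechanism (model p) u v s = update v s u"
proof -
  have "B \<in> parents G T" using edge by (simp add: parents_def)
  then show ?thesis by (auto simp: mechanism_def model_def update_def)
qed

text \<open>\<open>p\<close> enters the exogenous distribution only; as functions of
  \<open>u\<close> the responses of all these models coincide.\<close>

lemma response_model: "response (model p) u r = response (model q) u r"
proof -
  have "mechanism (model p) = mechanism (model q)"
    by (intro ext) simp
  then have "solves (model p) = solves (model q)"
    unfolding solves_def model_simps by (simp only:)
  then show ?thesis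
    by (simp add: response_def)
qed

lemma recursive_model: "recursive_scm (model p)"
proof -
  have "{(w, v). v \<in> verts G \<and> w \<in> parents G v} = dedges G"
    using diagram by (auto simp: parents_def causal_diagram_def)
  moreover have "parents G v \<subseteq> verts G" for v
    using diagram by (auto simp: parents_def causal_diagram_def)
  moreover have "update v s u \<le> m + 1" for v s u
    by (auto simp: update_def decode_def signal_def)
  ultimately show ?thesis
    using diagram by (simp add: recursive_scm_def causal_diagram_def)
qed

text \<open>Disjoint sets of variables read disjoint coordinates of a product distribution, so they
  are independent whatever the bidirected edges are.\<close>

lemma compatible_model: "compatible (model p) G"
proof -
  let ?P = "\<lambda>i. noisy (if i = e T then p else coins)"
  have "exo_indep (model p) A C"
    if AC: "A \<subseteq> verts G" "C \<subseteq> verts G" "A \<inter> C = {}" for A C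
  proof -
    let ?U = "measure_pmf (Pi_pmf (e ` verts G) 0 ?P)"
    have "e ` A \<inter> e ` C = {}"
      using inj_on_image_Int[OF e AC(1,2)] AC(3) by simp
    then have "prob_space.indep_var ?U
        (PiM (e ` A) (\<lambda>_. count_space UNIV)) (\<lambda>u. restrict (\<lambda>i. u i) (e ` A))
        (PiM (e ` C) (\<lambda>_. count_space UNIV)) (\<lambda>u. restrict (\<lambda>i. u i) (e ` C))"
      by (intro prob_space.indep_var_restrict[OF measure_pmf.prob_space_axioms indep_vars_Pi_pmf])
        (use AC in auto)
    \<comment> \<open>Over finitely many coordinates in \<open>nat\<close> the product sigma-algebra
      is the discrete one that \<open>exo_indep\<close> asks for.\<close>
    moreover have "id \<in> measurable (PiM (e ` D) (\<lambda>_. count_space (UNIV :: nat set))) (count_space UNIV)"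
      if "D \<subseteq> verts G" for D
    proof -
      have "finite (e ` D)" using that finite_verts by (meson finite_imageI finite_subset)
      then show ?thesis
        by (subst count_space_PiM_finite) auto
    qed
    ultimately have "prob_space.indep_var ?U (count_space UNIV) (id \<circ> (\<lambda>u. restrict u (e ` A)))
        (count_space UNIV) (id \<circ> (\<lambda>u. restrict u (e ` C)))"
      using AC by (intro prob_space.indep_var_compose[OF measure_pmf.prob_space_axioms]) auto
    moreover have "(\<Union>a\<in>D. {e a}) = e ` D" for D by auto
    ultimately show ?thesis by (simp add: exo_indep_def comp_def model_def)
  qed
  then show ?thesis by (simp add: compatible_def)
qed

section \<open>Agreement of the models on \<open>L2_5\<close>\<close>

lemma decode_encode: "decode \<beta> (encode b) = signal (if \<beta> then fst b else snd b)"
  by (auto simp: decode_def encode_def)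

text \<open>A fixed \<open>\<beta>\<close> reads a single bit, whose law is a marginal, and the
  noise does not involve \<open>p\<close>.\<close>

lemma map_decode_noisy:
  assumes "map_pmf fst p = map_pmf fst q" "map_pmf snd p = map_pmf snd q"
  shows "map_pmf (decode \<beta>) (noisy p) = map_pmf (decode \<beta>) (noisy q)"
proof -
  have "map_pmf (decode \<beta>) (map_pmf encode r) =
      map_pmf signal (if \<beta> then map_pmf fst r else map_pmf snd r)" for r
    by (simp add: pmf.map_comp comp_def decode_encode)
  then have "map_pmf (decode \<beta>) (map_pmf encode p) = map_pmf (decode \<beta>) (map_pmf encode q)"
    using assms by simp
  then show ?thesis
    unfolding noisy_def map_bind_pmf by (intro bind_pmf_cong) auto
qed

lemma subscript_none:
  assumes "query_over V Q" "(Y, x) \<in> Q" "S \<in> ancestors (cut_out G (dom x)) Y"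
  shows "x S = None"
  using assms(3)
proof (induction rule: ancestors_cut_out_induct)
  case refl
  then show ?case using assms(1,2) unfolding query_over_def ball_pair by blast
qed auto

text \<open>All responses in \<open>Z\<close> with \<open>T\<close> as counterfactual ancestor share
  one reduced subscript of \<open>T\<close>. So \<open>B\<close> has the same value in all their
  worlds, and, not being a descendant of \<open>T\<close>, it does not react to \<open>k\<close>.
  Hence one \<open>\<beta>\<close>, which may depend on the other coordinates of \<open>u\<close>,
  decodes for the whole query.\<close>

lemma response_depends_on_decoded:
  assumes Z: "in_layer G L2_5 Z"
  obtains \<beta> where "\<And>k k' r. decode \<beta> k = decode \<beta> k' \<Longrightarrow> r \<in> Z \<Longrightarrow>
    response (model p) (u(e T := k)) r = response (model q) (u(e T := k')) r"
proof -
  let ?M = "model p" and ?u = "\<lambda>k. u(e T := k)"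
  have over: "query_over (verts G) Z"
    using Z by (simp add: in_layer_def)
  have same: "x |` ancestors (cut_in G (dom x)) S = x' |` ancestors (cut_in G (dom x')) S"
    if "(Y, x) \<in> Z" "S \<in> ancestors (cut_out G (dom x)) Y"
      "(Y', x') \<in> Z" "S \<in> ancestors (cut_out G (dom x')) Y'" for Y x Y' x' S
    using Z that unfolding in_layer_def layer_condition.simps ball_pair ctf_ancestors_iff by blast
  have other: "?u k (e v) = u (e v)" if "v \<in> verts G" "v \<noteq> T" for k v
    using that e T_vert by (auto dest: inj_onD)
  note models = response_model[of q _ _ p]
  have update_other: "update v s (?u k) = update v s' (?u k')"
    if "v \<in> verts G" "v \<noteq> T" "\<And>w. w \<in> parents G v \<Longrightarrow> s w = s' w" for v s s' k k'
    using that other[OF that(1,2)] by (simp add: update_def)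
  have parent_vert: "w \<in> verts G" if "w \<in> parents G v" for w v
    using that diagram by (auto simp: parents_def causal_diagram_def)
  have unaffected: "response ?M (?u k) (Y, x) = response ?M (?u k') (Y, x)"
    if YZ: "(Y, x) \<in> Z" and T: "T \<notin> ancestors (cut_out G (dom x)) Y" for Y x k k'
    unfolding response_solution
  \<comment> \<open>If \<open>T\<close> lies in this set, it is intervened, and its mechanism is not
    evaluated.\<close>
  proof (rule solution_eq_on[OF recursive_model, where S = "ancestors (cut_out G (dom x)) Y \<union> dom x"])
    have YV: "Y \<in> verts G" "dom x \<subseteq> verts G"
      using over YZ unfolding query_over_def ball_pair by blast+
    show sub: "ancestors (cut_out G (dom x)) Y \<union> dom x \<subseteq> obs ?M"
      using YV ancestors_cut_out[of G "dom x" Y] ancestors_in_verts[OF diagram YV(1)] by auto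
    show "w \<in> ancestors (cut_out G (dom x)) Y \<union> dom x"
      if "v \<in> ancestors (cut_out G (dom x)) Y \<union> dom x" "x v = None" "w \<in> pa ?M v" for v w
      using that edge_ancestor_cut_out[of w v G "dom x" Y] by (auto simp: parents_def)
    show "mechanism ?M (?u k) v (solution ?M x (?u k)) = mechanism ?M (?u k') v (solution ?M x (?u k'))"
      if "v \<in> ancestors (cut_out G (dom x)) Y \<union> dom x" "x v = None"
        "\<And>w. w \<in> pa ?M v \<Longrightarrow> solution ?M x (?u k) w = solution ?M x (?u k') w" for v
    proof -
      have "v \<in> verts G" using that(1) sub by auto
      moreover have "v \<noteq> T" using that(1,2) T by auto
      ultimately show ?thesis
        using that(3) by (simp add: update_other)
    qed
  qed auto
  show thesis
  proof (cases "\<exists>Y x. (Y, x) \<in> Z \<and> T \<in> ancestors (cut_out G (dom x)) Y")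
    case False
    have "response ?M (?u k) r = response (model q) (?u k') r" if "r \<in> Z" for k k' r
      unfolding models using that False unaffected by (cases r) blast
    then show thesis
      by (rule that)
  next
    case True
    then obtain Y0 x0 where Y0: "(Y0, x0) \<in> Z" "T \<in> ancestors (cut_out G (dom x0)) Y0"
      by blast
    \<comment> \<open>The code 0 is an arbitrary reference; \<open>B0\<close> shows that the value
      of \<open>B\<close> is the same for every code.\<close>
    define \<beta> where "\<beta> = (solution ?M x0 (?u 0) B = c)"
    have B0: "solution ?M x0 (?u k) B = solution ?M x0 (?u 0) B" for k
    proof (rule solution_eq_on[OF recursive_model, where S = "ancestors G B"])
      show sub: "ancestors G B \<subseteq> obs ?M"
        using ancestors_in_verts[OF diagram B_vert] by simp
      show "w \<in> ancestors G B" if "v \<in> ancestors G B" "w \<in> pa ?M v" for v w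
        using that by (auto simp: ancestors_def parents_def intro: converse_rtrancl_into_rtrancl)
      have "T \<notin> ancestors G B"
        using ancestors_antisym[OF diagram, of T B] edge B_neq_T by (auto simp: ancestors_def)
      then show "mechanism ?M (?u k) v (solution ?M x0 (?u k)) = mechanism ?M (?u 0) v (solution ?M x0 (?u 0))"
        if "v \<in> ancestors G B" "\<And>w. w \<in> pa ?M v \<Longrightarrow> solution ?M x0 (?u k) w = solution ?M x0 (?u 0) w" for v
      proof -
        have "v \<in> verts G" "v \<noteq> T"
          using that(1) sub \<open>T \<notin> ancestors G B\<close> by auto
        then show ?thesis using that(2) by (simp add: update_other)
      qed
    qed auto
    have BT: "B \<in> ancestors (cut_in G (dom x)) T" if "x T = None" for x :: "'v subscript"
      using that edge by (intro parent_ancestor_cut_in) (auto simp: parents_def)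
    \<comment> \<open>The shared reduced subscript of \<open>T\<close> makes both worlds treat its
      parent \<open>B\<close> alike: either \<open>B\<close> is fixed to the same value, or it is
      itself a shared counterfactual ancestor.\<close>
    have Bx: "solution ?M x w B = solution ?M x0 w B"
      if Y: "(Y, x) \<in> Z" "T \<in> ancestors (cut_out G (dom x)) Y" for Y x w
    proof -
      have none: "x T = None" "x0 T = None"
        using subscript_none[OF over] Y Y0 by blast+
      have eq: "x B = x0 B"
        using fun_cong[OF same[OF Y Y0], of B] BT[of x, OF none(1)] BT[of x0, OF none(2)] by simp
      show ?thesis
      proof (cases "x B")
        case (Some b)
        then show ?thesis
          using eq solution_intervened[OF recursive_model, of B p] B_vert by (metis model_simps(1))
      next
        case None
        then have "x |` ancestors (cut_in G (dom x)) B = x0 |` ancestors (cut_in G (dom x0)) B"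
          using eq by (intro same[OF Y(1) _ Y0(1)] edge_ancestor_cut_out[OF edge] Y Y0) auto
        then show ?thesis
          using solution_reduced[OF recursive_model compatible_model diagram B_vert] by metis
      qed
    qed
    have affected: "response ?M (?u k) (Y, x) = response ?M (?u k') (Y, x)"
      if Y: "(Y, x) \<in> Z" "T \<in> ancestors (cut_out G (dom x)) Y" and k: "decode \<beta> k = decode \<beta> k'"
      for Y x k k'
      unfolding response_solution
    proof (rule solution_eq_on[OF recursive_model, where S = "verts G"])
      show "Y \<in> verts G"
        using over Y(1) unfolding query_over_def ball_pair by blast
      show "mechanism ?M (?u k) v (solution ?M x (?u k)) = mechanism ?M (?u k') v (solution ?M x (?u k'))"
        if v: "v \<in> verts G" "\<And>w. w \<in> pa ?M v \<Longrightarrow> solution ?M x (?u k) w = solution ?M x (?u k') w" for v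
      proof (cases "v = T")
        case True
        have "(solution ?M x (?u l) B = c) = \<beta>" for l
          using Bx[OF Y, of "?u l"] B0[of l] by (simp add: \<beta>_def)
        then show ?thesis
          using True k by (simp add: update_def)
      next
        case False
        then show ?thesis using v by (simp add: update_other)
      qed
    qed (auto intro: parent_vert)
    have "response ?M (?u k) r = response (model q) (?u k') r"
      if "decode \<beta> k = decode \<beta> k'" "r \<in> Z" for k k' r
    proof (cases r)
      case (Pair Y x)
      then show ?thesis
        unfolding models using that affected unaffected
        by (cases "T \<in> ancestors (cut_out G (dom x)) Y") blast+
    qed
    then show thesis
      by (rule that)
  qed
qed

text \<open>Given all exogenous coordinates except that of \<open>T\<close>, the event depends only
  on a decoded code, whose law is determined by the marginals.\<close>

lemma agree_models:
  assumes "map_pmf fst p = map_pmf fst q" "map_pmf snd p = map_pmf snd q"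
  shows "agree_on (model p) (model q) G L2_5"
  unfolding agree_on_def
proof (intro allI impI)
  fix Z y assume "in_layer G L2_5 Z \<and> subscripts_in (vals (model p)) Z"
  then have Z: "in_layer G L2_5 Z" by simp
  define E where "E = {u. \<forall>r\<in>Z. response (model p) u r = y r}"
  have Eq: "E = {u. \<forall>r\<in>Z. response (model q) u r = y r}"
    by (simp add: E_def response_model[of p _ _ q])
  let ?I = "e ` verts G - {e T}" and ?W = "Pi_pmf (e ` verts G - {e T}) 0 (\<lambda>_. noisy coins)"
  have pu: "pu (model r) = bind_pmf ?W (\<lambda>w. map_pmf (\<lambda>k. w(e T := k)) (noisy r))" for r
  proof -
    have "pu (model r) = Pi_pmf (insert (e T) ?I) 0 (\<lambda>i. noisy (if i = e T then r else coins))"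
      using T_vert by (simp add: model_def insert_absorb)
    also have "\<dots> = bind_pmf (noisy r) (\<lambda>k. bind_pmf (Pi_pmf ?I 0 (\<lambda>i. noisy (if i = e T then r else coins)))
        (\<lambda>w. return_pmf (w(e T := k))))"
      by (subst Pi_pmf_insert') auto
    also have "Pi_pmf ?I 0 (\<lambda>i. noisy (if i = e T then r else coins)) = ?W"
      by (intro Pi_pmf_cong) auto
    finally show ?thesis
      by (subst (asm) bind_commute_pmf) (simp add: map_pmf_def)
  qed
  have "map_pmf (\<lambda>k. w(e T := k) \<in> E) (noisy p) = map_pmf (\<lambda>k. w(e T := k) \<in> E) (noisy q)" for w
  proof -
    obtain \<beta> where \<beta>: "\<And>k k' r. decode \<beta> k = decode \<beta> k' \<Longrightarrow> r \<in> Z \<Longrightarrow>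
        response (model p) (w(e T := k)) r = response (model p) (w(e T := k')) r"
      using response_depends_on_decoded[OF Z] by blast
    define h where "h d = (\<exists>k. decode \<beta> k = d \<and> w(e T := k) \<in> E)" for d
    have "w(e T := k) \<in> E" if "decode \<beta> k' = decode \<beta> k" "w(e T := k') \<in> E" for k k'
      unfolding E_def using that(2) \<beta>[OF that(1)] by (simp add: E_def)
    then have "(\<lambda>k. w(e T := k) \<in> E) = h \<circ> decode \<beta>"
      unfolding h_def comp_def by blast
    then show ?thesis
      using map_decode_noisy[OF assms] by (simp flip: pmf.map_comp)
  qed
  then have "map_pmf (\<lambda>u. u \<in> E) (pu (model p)) = map_pmf (\<lambda>u. u \<in> E) (pu (model q))"
    unfolding pu map_bind_pmf by (intro bind_pmf_cong) (simp_all add: pmf.map_comp comp_def)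
  then show "query_prob (model p) Z y = query_prob (model q) Z y"
    unfolding query_prob_def E_def[symmetric] Eq[symmetric] measure_pmf_as_pmf by simp
qed

section \<open>Positivity through noise\<close>

lemma measure_noisy:
  assumes "K \<subseteq> {m + 2..}"
  shows "measure_pmf.prob (noisy p) K = (1 - \<delta>) * measure_pmf.prob p (encode -` K)"
proof -
  have "measure_pmf.prob (pmf_of_set {..m + 1}) K = 0"
    using assms by (intro measure_pmf_zero_iff[THEN iffD2]) auto
  moreover have "measure_pmf.prob (noisy p) K =
      (\<integral>b. measure_pmf.prob (if b then pmf_of_set {..m + 1} else map_pmf encode p) K \<partial>bernoulli_pmf \<delta>)"
    unfolding noisy_def measure_pmf_as_pmf map_bind_pmf pmf_bind ..
  ultimately show ?thesis
    using \<delta> by (simp add: measure_map_pmf)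
qed

lemma set_noisy: "{..m + 1} \<subseteq> set_pmf (noisy p)"
  using \<delta> by (auto simp: noisy_def set_pmf_bernoulli)

text \<open>A variable copies a noise value regardless of its parents, so suitable noise yields
  \<open>y\<close> in all worlds at once.\<close>

lemma positive_model: "positive_on (model p) G L2_5"
  unfolding positive_on_def
proof (intro allI impI)
  fix Z y
  assume A: "in_layer G L2_5 Z \<and> subscripts_in (vals (model p)) Z \<and>
    (\<forall>r\<in>Z. y r \<in> vals (model p) (fst r)) \<and>
    (\<forall>r\<in>Z. \<forall>s\<in>Z. reduced G r = reduced G s \<longrightarrow> y r = y s)"
  then have "in_layer G L2_5 Z" and yv: "\<And>r. r \<in> Z \<Longrightarrow> y r \<in> vals (model p) (fst r)" and red: "\<And>r s. r \<in> Z \<Longrightarrow> s \<in> Z \<Longrightarrow> reduced G r = reduced G s \<Longrightarrow> y r = y s"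
    by blast+
  then have over: "query_over (verts G) Z" and Z: "layer_condition G L2_5 Z"
    unfolding in_layer_def by blast+
  have y: "y r \<le> m + 1" if "r \<in> Z" for r
    using yv[OF that] by simp
  \<comment> \<open>In \<open>L2_5\<close> two responses of one variable have the same reduced
    subscript, so \<open>y\<close> assigns one value per variable.\<close>
  have eq: "y r = y s" if "r \<in> Z" "s \<in> Z" "fst r = fst s" for r s
  proof -
    have anc: "reduced G q \<in> ctf_ancestors G Z" if "q \<in> Z" for q
      using that unfolding ctf_ancestors_iff reduced_def
      by (intro exI[of _ "fst q"] exI[of _ "snd q"]) simp
    have "v = w" if "(W, v) \<in> ctf_ancestors G Z" "(W, w) \<in> ctf_ancestors G Z" for W v w
      using Z that unfolding layer_condition.simps ball_pair by blast
    then have "reduced G r = reduced G s"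
      using anc[OF that(1)] anc[OF that(2)] that(3) unfolding reduced_def by simp
    then show ?thesis using red that by blast
  qed
  define g where "g v = (if \<exists>r\<in>Z. fst r = v then y (SOME r. r \<in> Z \<and> fst r = v) else 0)" for v
  have g: "g (fst r) = y r" if "r \<in> Z" for r
  proof -
    let ?s = "SOME s. s \<in> Z \<and> fst s = fst r"
    have "?s \<in> Z \<and> fst ?s = fst r"
      by (rule someI[of _ r]) (use that in simp)
    then have "y ?s = y r"
      using eq that by blast
    then show ?thesis using that unfolding g_def by auto
  qed
  have g_le: "g v \<le> m + 1" for v
  proof (cases "\<exists>r\<in>Z. fst r = v")
    case True
    then show ?thesis using g y by force
  qed (simp add: g_def)
  define u where "u i = (if i \<in> e ` verts G then g (inv_into (verts G) e i) else 0)" for i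
  have u: "u (e v) = g v" if "v \<in> verts G" for v
    using that e by (simp add: u_def)
  have "u \<in> set_pmf (pu (model p))"
    using g_le set_noisy unfolding model_def
    by (auto simp: set_Pi_pmf PiE_dflt_def u_def)
  moreover have "u \<in> {u. \<forall>r\<in>Z. response (model p) u r = y r}"
  proof (intro CollectI ballI)
    fix r assume r: "r \<in> Z"
    obtain Y x where Yx: "r = (Y, x)" by (cases r)
    have Y: "Y \<in> verts G" "x Y = None"
      using over r unfolding Yx query_over_def ball_pair by blast+
    have "update Y s u = g Y" for s
      using u[OF Y(1)] g_le[of Y] by (cases "Y = T") (simp_all add: update_def decode_def)
    then have "solution (model p) x u Y = g Y"
      using solution_mechanism[OF recursive_model, of Y p x u] Y by simp
    then show "response (model p) u r = y r"
      using g[OF r] by (simp add: Yx response_solution)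
  qed
  ultimately show "query_prob (model p) Z y > 0"
    unfolding query_prob_def by (rule measure_pmf_posI)
qed

section \<open>A value vector that separates the two models\<close>

definition quiet :: "(nat \<Rightarrow> nat) \<Rightarrow> bool" where
  "quiet u \<longleftrightarrow> (\<forall>v\<in>verts G. u (e v) \<ge> m + 2)"

lemma measure_quiet:
  assumes "K \<subseteq> {m + 2..}"
  shows "measure_pmf.prob (pu (model p)) {u. quiet u \<and> u (e T) \<in> K} =
    (1 - \<delta>) ^ card (verts G) * measure_pmf.prob p (encode -` K)"
proof -
  let ?I = "e ` verts G"
  have "u \<in> Pi ?I (\<lambda>i. if i = e T then K else {m + 2..}) \<longleftrightarrow> quiet u \<and> u (e T) \<in> K" for u
  proof -
    have "u \<in> Pi ?I (\<lambda>i. if i = e T then K else {m + 2..}) \<longleftrightarrow>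
        (\<forall>v\<in>verts G. u (e v) \<in> (if v = T then K else {m + 2..}))"
      using T_vert by (simp add: Pi_iff inj_on_eq_iff[OF e] cong: ball_cong)
    also have "\<dots> \<longleftrightarrow> quiet u \<and> u (e T) \<in> K"
      using T_vert assms unfolding quiet_def by (auto split: if_splits)
    finally show ?thesis .
  qed
  then have "{u. quiet u \<and> u (e T) \<in> K} = Pi ?I (\<lambda>i. if i = e T then K else {m + 2..})"
    by blast
  then have "measure_pmf.prob (pu (model p)) {u. quiet u \<and> u (e T) \<in> K} =
      (\<Prod>i\<in>?I. measure_pmf.prob (noisy (if i = e T then p else coins)) (if i = e T then K else {m + 2..}))"
    by (simp add: model_def measure_Pi_pmf_Pi)
  also have "\<dots> = measure_pmf.prob (noisy p) K *
      (\<Prod>i\<in>?I - {e T}. measure_pmf.prob (noisy (if i = e T then p else coins)) (if i = e T then K else {m + 2..}))"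
    using T_vert by (subst prod.remove[of _ "e T"]) auto
  also have "(\<Prod>i\<in>?I - {e T}. measure_pmf.prob (noisy (if i = e T then p else coins)) (if i = e T then K else {m + 2..})) =
      (\<Prod>i\<in>?I - {e T}. 1 - \<delta>)"
  proof (intro prod.cong refl)
    fix i assume "i \<in> ?I - {e T}"
    moreover have "encode -` {m + 2..} = UNIV"
      by (auto simp: encode_def)
    ultimately show "measure_pmf.prob (noisy (if i = e T then p else coins)) (if i = e T then K else {m + 2..}) = 1 - \<delta>"
      using measure_noisy[of "{m + 2..}" coins] by simp
  qed
  also have "\<dots> = (1 - \<delta>) ^ (card (verts G) - 1)"
    using T_vert by (simp add: card_image[OF e])
  also have "measure_pmf.prob (noisy p) K * \<dots> =
      (1 - \<delta>) ^ card (verts G) * measure_pmf.prob p (encode -` K)"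
    using T_vert card_gt_0_iff[of "verts G"]
    by (subst measure_noisy[OF assms], subst power_eq_if) auto
  finally show ?thesis .
qed

text \<open>Let \<open>q\<close> be the probability that nothing is noisy. The responses that occur
  when all bits are clear have probability at least \<open>q / 2\<close> under \<open>tied\<close>
  and at most \<open>1 - 3 * q / 4\<close> under \<open>coins\<close>; these bounds separate exactly
  when \<open>q > 4/5\<close>.\<close>

lemma not_identified:
  assumes over: "query_over (verts G) Q"
    and Y: "(Y, x) \<in> Q" "T \<in> ancestors (cut_out G (dom x)) Y" "x B = Some c"
    and Y': "(Y', x') \<in> Q" "T \<in> ancestors (cut_out G (dom x')) Y'" "x' B \<noteq> Some c"
    and bound: "\<And>Y x w a. (Y, x) \<in> Q \<Longrightarrow> x w = Some a \<Longrightarrow> a < m"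
    and noise: "(1 - \<delta>) ^ card (verts G) > 4 / 5"
  shows "\<exists>y. query_prob (model coins) Q y \<noteq> query_prob (model tied) Q y"
proof -
  let ?M = "model coins"
  \<comment> \<open>\<open>m + 2\<close> is the code of \<open>(False, False)\<close>.\<close>
  define y where "y = response ?M (\<lambda>_. m + 2)"
  have parent_vert: "w \<in> verts G" if "w \<in> parents G v" for w v
    using that diagram by (auto simp: parents_def causal_diagram_def)
  \<comment> \<open>No signal can arise: both bits of \<open>T\<close> are clear, and interventions
    only set values below \<open>m\<close>.\<close>
  have no_signal: "v \<in> verts G \<longrightarrow> solution ?M z (\<lambda>_. m + 2) v \<noteq> m + 1" if "(W, z) \<in> Q" for W z v
  proof (induction v rule: wf_induct_rule[OF wf_parents[OF recursive_model[of coins]]])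
    case (1 v)
    show ?case
    proof
      assume v: "v \<in> verts G"
      show "solution ?M z (\<lambda>_. m + 2) v \<noteq> m + 1"
      proof (cases "z v")
        case None
        have "solution ?M z (\<lambda>_. m + 2) w \<noteq> m + 1" if "w \<in> parents G v" for w
          using 1[of w] v that parent_vert[OF that] by simp
        then have "update v (solution ?M z (\<lambda>_. m + 2)) (\<lambda>_. m + 2) = m"
          by (auto simp: update_def decode_def signal_def)
        then show ?thesis
          using solution_mechanism[OF recursive_model, of v coins z] v None by simp
      next
        case (Some a)
        then show ?thesis
          using bound[OF that Some] solution_intervened[OF recursive_model, of v coins z a] v by simp
      qed
    qed
  qed
  have transmitted: "solution ?M z u W = m + 1"
    if W: "(W, z) \<in> Q" "T \<in> ancestors (cut_out G (dom z)) W" "quiet u" "solution ?M z u T = m + 1"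
    for W z u
  proof -
    \<comment> \<open>The induction runs backwards from \<open>W\<close>. That \<open>T\<close> is
      an ancestor of \<open>S\<close> ensures that the next vertex is not \<open>T\<close>, which
      does not relay signals.\<close>
    have "T \<in> ancestors G S \<longrightarrow> solution ?M z u S = m + 1 \<longrightarrow> solution ?M z u W = m + 1"
      if "S \<in> ancestors (cut_out G (dom z)) W" for S
      using that
    proof (induction rule: ancestors_cut_out_induct)
      case (step S S')
      show ?case
      proof (intro impI)
        assume T: "T \<in> ancestors G S" and sig: "solution ?M z u S = m + 1"
        have S: "S \<in> parents G S'" "S \<in> ancestors G S'" "S \<noteq> S'" "S' \<in> verts G"
          using step(1) diagram by (auto simp: parents_def ancestors_def causal_diagram_def acyclic_def)
        then have TS: "T \<in> ancestors G S'" using T by (blast intro: ancestors_trans)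
        have "S' \<noteq> T"
          using ancestors_antisym[OF diagram S(2)] T S(3) by blast
        moreover have "u (e S') \<ge> m + 2"
          using W(3) S(4) by (simp add: quiet_def)
        ultimately have "update S' (solution ?M z u) u = m + 1"
          using sig S(1) by (auto simp: update_def signal_def)
        then have "solution ?M z u S' = m + 1"
          using solution_mechanism[OF recursive_model, of S' coins z u] S(4)
            subscript_none[OF over W(1) step(3)] by simp
        then show "solution ?M z u W = m + 1"
          using step(4) TS by blast
      qed
    qed simp
    then show ?thesis using W(2,4) by simp
  qed
  have decoded: "decode (solution ?M z u B = c) (u (e T)) \<noteq> m + 1"
    if W: "(W, z) \<in> Q" "T \<in> ancestors (cut_out G (dom z)) W" and u: "quiet u"
      "\<forall>r\<in>Q. response ?M u r = y r" for W z u
  proof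
    assume "decode (solution ?M z u B = c) (u (e T)) = m + 1"
    then have "solution ?M z u T = m + 1"
      using solution_mechanism[OF recursive_model, of T coins z u] T_vert subscript_none[OF over W]
      by (simp add: update_def)
    then have "solution ?M z u W = m + 1"
      using transmitted[OF W u(1)] by simp
    moreover have "solution ?M z u W = solution ?M z (\<lambda>_. m + 2) W"
      using u(2) W(1) by (auto simp: y_def simp flip: response_solution)
    moreover have "W \<in> verts G"
      using over W(1) unfolding query_over_def ball_pair by blast
    ultimately show False using no_signal[OF W(1), of W] by simp
  qed
  \<comment> \<open>These are the codes with a set bit. The world of \<open>x\<close> exposes the
    first bit and that of \<open>x'\<close> the second, so a set bit would show in some
    response.\<close>
  have "\<not> (quiet u \<and> u (e T) \<in> {m + 3, m + 4, m + 5})" if u: "\<forall>r\<in>Q. response ?M u r = y r" for u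
  proof
    assume q: "quiet u \<and> u (e T) \<in> {m + 3, m + 4, m + 5}"
    have "solution ?M x u B = c"
      using solution_intervened[OF recursive_model, of B coins x c u] B_vert Y(3) by simp
    then have 1: "decode True (u (e T)) \<noteq> m + 1"
      using decoded[OF Y(1,2) _ u] q by simp
    \<comment> \<open>An unsubscripted quiet \<open>B\<close> takes the value \<open>m\<close> or
      \<open>m + 1\<close>, whereas \<open>c\<close> is below \<open>m\<close>.\<close>
    have "solution ?M x' u B \<noteq> c"
    proof (cases "x' B")
      case (Some a)
      then show ?thesis
        using solution_intervened[OF recursive_model, of B coins x' a u] B_vert Y'(3) by simp
    next
      case None
      have "u (e B) \<ge> m + 2"
        using q B_vert by (simp add: quiet_def)
      then have "update B (solution ?M x' u) u \<ge> m"
        using B_neq_T by (simp add: update_def signal_def)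
      then show ?thesis
        using solution_mechanism[OF recursive_model, of B coins x' u] B_vert None c by simp
    qed
    then have 2: "decode False (u (e T)) \<noteq> m + 1"
      using decoded[OF Y'(1,2) _ u] q by simp
    show False
      using 1 2 q by (auto simp: decode_def signal_def)
  qed
  then have "{u. \<forall>r\<in>Q. response ?M u r = y r} \<subseteq> - {u. quiet u \<and> u (e T) \<in> {m + 3, m + 4, m + 5}}"
    by blast
  then have "query_prob ?M Q y \<le> measure_pmf.prob (pu ?M) (- {u. quiet u \<and> u (e T) \<in> {m + 3, m + 4, m + 5}})"
    unfolding query_prob_def by (rule measure_pmf.finite_measure_mono) simp
  also have "\<dots> = 1 - (1 - \<delta>) ^ card (verts G) * measure_pmf.prob coins (encode -` {m + 3, m + 4, m + 5})"
    by (subst measure_quiet[symmetric]) (auto simp: measure_pmf.prob_compl[symmetric] Compl_eq_Diff_UNIV)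
  also have "encode -` {m + 3, m + 4, m + 5} = UNIV - {(False, False)}"
    by (auto simp: encode_def of_bool_def split: if_splits)
  also have "measure_pmf.prob coins (UNIV - {(False, False)}) = 3 / 4"
    by (subst measure_pmf.prob_compl[of _ coins, simplified])
      (simp_all add: coins_def measure_pmf_single pmf_pair)
  finally have M: "query_prob ?M Q y \<le> 1 - (1 - \<delta>) ^ card (verts G) * (3 / 4)" .
  \<comment> \<open>Other variables treat all codes alike, so only the code of \<open>T\<close> has
    to be \<open>m + 2\<close>.\<close>
  have silent: "response (model tied) u r = y r"
    if u: "quiet u" "u (e T) = m + 2" and r: "r \<in> Q" for u r
  proof -
    obtain W z where Wz: "r = (W, z)" by (cases r)
    have "solution ?M z u W = solution ?M z (\<lambda>_. m + 2) W"
    proof (rule solution_eq_on[OF recursive_model, where S = "verts G"])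
      show "W \<in> verts G"
        using over r unfolding Wz query_over_def ball_pair by blast
      show "mechanism ?M u v (solution ?M z u) = mechanism ?M (\<lambda>_. m + 2) v (solution ?M z (\<lambda>_. m + 2))"
        if "v \<in> verts G" "\<And>w. w \<in> pa ?M v \<Longrightarrow> solution ?M z u w = solution ?M z (\<lambda>_. m + 2) w" for v
      proof -
        have "u (e v) \<ge> m + 2"
          using u(1) that(1) by (simp add: quiet_def)
        moreover have "solution ?M z u B = solution ?M z (\<lambda>_. m + 2) B" if "v = T"
          using \<open>\<And>w. w \<in> pa ?M v \<Longrightarrow> _ w\<close> edge that by (simp add: parents_def)
        ultimately show ?thesis
          using u(2) that(2) by (simp add: update_def)
      qed
    qed (auto intro: parent_vert)
    then have "response ?M u r = y r"
      by (simp add: y_def Wz response_solution)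
    then show ?thesis
      by (simp add: response_model[of tied _ _ coins])
  qed
  have "(1 - \<delta>) ^ card (verts G) * (1 / 2) =
      (1 - \<delta>) ^ card (verts G) * measure_pmf.prob tied (encode -` {m + 2})"
  proof -
    have "(\<lambda>b. (b, b)) -` encode -` {m + 2} = {False}"
      by (auto simp: encode_def)
    then show ?thesis
      by (simp add: tied_def measure_map_pmf measure_pmf_single)
  qed
  also have "\<dots> = measure_pmf.prob (pu (model tied)) {u. quiet u \<and> u (e T) \<in> {m + 2}}"
    by (rule measure_quiet[symmetric]) simp
  also have "\<dots> \<le> query_prob (model tied) Q y"
    unfolding query_prob_def by (rule measure_pmf.finite_measure_mono) (use silent in auto)
  finally show ?thesis
    using M noise by (intro exI[of _ y]) simp
qed

end

section \<open>Passage to all layers below \<open>L3\<close>\<close>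

lemma in_layer_imp_L2_5:
  assumes "causal_diagram G" "in_layer G j Q" "layer_index j < layer_index L3"
  shows "in_layer G L2_5 Q"
proof (cases j)
  case L1
  then show ?thesis
    using assms L1_imp_L2[of G Q] L2_imp_L2_25[of G Q] L2_25_imp_L2_5[of G Q] by blast
next
  case L2
  then show ?thesis
    using assms L2_imp_L2_25[of G Q] L2_25_imp_L2_5[of G Q] by blast
next
  case L2_25
  then show ?thesis
    using assms L2_25_imp_L2_5[of G Q] by blast
qed (use assms in simp_all)

lemma L3_not_identifiable:
  assumes G: "causal_diagram G" and Q: "in_layer G L3 Q" "\<not> in_layer G L2_5 Q"
    and j: "layer_index j < layer_index L3"
  shows "\<not> identifiable G j Q"
proof -
  have over: "query_over (verts G) Q"
    using Q(1) by (simp add: in_layer_def)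
  have "\<not> layer_condition G L2_5 Q"
    using Q(2) over unfolding in_layer_def by blast
  then obtain Y x Y' x' T B c where Y: "(Y, x) \<in> Q" and Y': "(Y', x') \<in> Q"
    and T: "T \<in> ancestors (cut_out G (dom x)) Y" "T \<in> ancestors (cut_out G (dom x')) Y'"
    and B: "(B, T) \<in> dedges G" "x B = Some c" "x' B \<noteq> Some c"
    by (rule not_L2_5_witness[OF G over])
  have fin: "finite (verts G)"
    using G by (simp add: causal_diagram_def)
  have "finite (ran z)" if "(W, z) \<in> Q" for W z
    using over that fin unfolding query_over_def ball_pair by (meson finite_ran finite_subset)
  then have "finite (\<Union>(W, z)\<in>Q. ran z)"
    using over by (intro finite_UN_I) (auto simp: query_over_def)
  then obtain m where m: "\<forall>a\<in>(\<Union>(W, z)\<in>Q. ran z). a < m"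
    unfolding finite_nat_set_iff_bounded by blast
  have bound: "a < m" if "(W, z) \<in> Q" "z w = Some a" for W z w a
    using m that by (auto simp: ran_def)
  obtain e :: "'a \<Rightarrow> nat" where e: "inj_on e (verts G)"
    using finite_imp_inj_to_nat_seg[OF fin] by blast
  define n where "n = card (verts G)"
  \<comment> \<open>Bernoulli's inequality then bounds the probability of no noise below by 5/6,
    above the threshold 4/5.\<close>
  define \<delta> :: real where "\<delta> = 1 / (6 * n)"
  have "B \<in> verts G"
    using G B(1) by (auto simp: causal_diagram_def)
  then have n: "n > 0"
    using fin by (auto simp: n_def card_gt_0_iff)
  then have small: "0 < \<delta>" "\<delta> < 1" "n * \<delta> = 1 / 6"
    by (auto simp: \<delta>_def field_simps)
  interpret clash G T B c m e \<delta>
    using G B(1) e small(1,2) bound[OF Y B(2)] by unfold_locales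
  have noise: "(1 - \<delta>) ^ card (verts G) > 4 / 5"
  proof -
    have "1 - n * \<delta> \<le> (1 - \<delta>) ^ n"
      using Bernoulli_inequality[of "- \<delta>" n] small(2) by simp
    then show ?thesis
      using small(3) unfolding n_def by linarith
  qed
  obtain y where y: "query_prob (model coins) Q y \<noteq> query_prob (model tied) Q y"
    using not_identified[OF over Y T(1) B(2) Y' T(2) B(3) _ noise] bound by metis
  \<comment> \<open>Positivity and agreement quantify over the queries of a layer, so they pass from
    \<open>L2_5\<close> to the layers it contains.\<close>
  have "positive_on (model p) G j" for p
    unfolding positive_on_def
  proof (intro allI impI, elim conjE)
    fix Z y assume Z: "in_layer G j Z"
      and *: "subscripts_in (vals (model p)) Z" "\<forall>r\<in>Z. y r \<in> vals (model p) (fst r)"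
        "\<forall>r\<in>Z. \<forall>s\<in>Z. reduced G r = reduced G s \<longrightarrow> y r = y s"
    show "query_prob (model p) Z y > 0"
      using positive_model[of p, unfolded positive_on_def, rule_format, OF conjI, OF in_layer_imp_L2_5[OF G Z j]] *
      by blast
  qed
  moreover have "agree_on (model coins) (model tied) G j"
  proof -
    have "map_pmf fst coins = map_pmf fst tied" "map_pmf snd coins = map_pmf snd tied"
      by (simp_all add: coins_def tied_def map_fst_pair_pmf map_snd_pair_pmf pmf.map_comp comp_def)
    then have "agree_on (model coins) (model tied) G L2_5"
      by (rule agree_models)
    then show ?thesis
      unfolding agree_on_def using in_layer_imp_L2_5[OF G _ j] by blast
  qed
  moreover have "subscripts_in (vals (model coins)) Q"
    using bound unfolding subscripts_in_def ball_pair by (auto simp: less_imp_le le_SucI)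
  moreover have "\<forall>v\<in>verts G. vals (model coins) v = vals (model tied) v"
    by simp
  ultimately show ?thesis
    using y recursive_model compatible_model unfolding identifiable_def by blast
qed

theorem theorem4p1:
  fixes V :: "'v set"
  shows
    "(\<forall>i\<in>{L2, L2_25, L2_5}. \<forall>Q :: 'v query.
       (\<exists>G. causal_diagram G \<and> verts G = V \<and> exactly_in_layer G i Q) \<longrightarrow>
       (\<forall>j. layer_index j < layer_index i \<longrightarrow>
          (\<exists>G. causal_diagram G \<and> verts G = V \<and> exactly_in_layer G i Q \<and> identifiable G j Q)))
     \<and>
     (\<forall>G. \<forall>Q :: 'v query.
       causal_diagram G \<and> verts G = V \<and> in_layer G L3 Q \<and> \<not> in_layer G L2_5 Q \<longrightarrow>
       \<not> identifiable G L2_5 Q \<and>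
       (\<forall>j. layer_index j < layer_index L3 \<longrightarrow> \<not> identifiable G j Q))"
proof (intro conjI ballI allI impI)
  fix i j and Q :: "'v query"
  assume "i \<in> {L2, L2_25, L2_5}"
    and "\<exists>G. causal_diagram G \<and> verts G = V \<and> exactly_in_layer G i Q"
  then show "\<exists>G. causal_diagram G \<and> verts G = V \<and> exactly_in_layer G i Q \<and> identifiable G j Q"
    using exists_identifying_diagram by metis
next
  fix G and Q :: "'v query"
  assume "causal_diagram G \<and> verts G = V \<and> in_layer G L3 Q \<and> \<not> in_layer G L2_5 Q"
  then show "\<not> identifiable G L2_5 Q"
    using L3_not_identifiable[of G Q L2_5] by simp
next
  fix G j and Q :: "'v query"
  assume "causal_diagram G \<and> verts G = V \<and> in_layer G L3 Q \<and> \<not> in_layer G L2_5 Q"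
    "layer_index j < layer_index L3"
  then show "\<not> identifiable G j Q"
    using L3_not_identifiable[of G Q j] by blast
qed

end
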